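(* For every equational nominal unification problem $P$, if the pattern unification problem $[P]$ is solvable, then $P$ is solvable.
   Context: Nominal setting. Nominal terms $t::=f(t_1,\dots,t_n)\mid a\mid a.t\mid\pi\cdot X$ over atoms $a$ (of sorts of atoms), variables $X$, function symbols $f$, and permutations $\pi$ (finite sequences of swappings $(a\,b)$ of same-sort atoms, acting on atoms and homomorphically on terms, with $(a\,b)\cdot(c.t)=((a\,b)\cdot c).((a\,b)\cdot t)$, $\pi\cdot(\pi'\cdot X)=(\pi\pi')\cdot X$). Substitutions replace variables without renaming, with $\sigma(\pi\cdot X)=\pi\cdot\sigma(X)$. A freshness environment $\nabla$ is a finite set of constraints $a\#X$; $\nabla\vdash a\#t$ and $\nabla\vdash t\approx u$ are the least relations closed under: $\nabla\vdash a\#a'$ if $a\ne a'$; $\nabla\vdash a\#\pi\cdot X$ if $(\pi^{-1}\cdot a)\#X\in\nabla$; $\nabla\vdash a\#f(\vec t)$ if all $\nabla\vdash a\#t_i$; $\nabla\vdash a\#a.t$; $\nabla\vdash a\#a'.t$ if $a\ne a'$, $\nabla\vdash a\#t$; $\nabla\vdash a\approx a$; $\nabla\vdash\pi\cdot X\approx\pi'\cdot X$ if $a\#X\in\nabla$ whenever $\pi\cdot a\ne\pi'\cdot a$; $\nabla\vdash f(\vec t)\approx f(\vec t')$ if all $\nabla\vdash t_i\approx t_i'$; $\nabla\vdash a.t\approx a.t'$ if $\nabla\vdash t\approx t'$; $\nabla\vdash a.t\approx a'.t'$ if $a\ne a'$, $\nabla\vdash t\approx(a\,a')\cdot t'$,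 $\nabla\vdash a\#t'$. An equational nominal unification problem $P$ is a finite set of equations $t\stackrel{?}{\approx}u$; it is solvable if some $\langle\nabla,\sigma\rangle$ satisfies $\nabla\vdash\sigma(t)\approx\sigma(u)$ for all equations. Translation: let $\langle a_1,\dots,a_n\rangle$ be an ordered list of the distinct atoms occurring in $P$. Base types named by sorts; $[\nu]=\nu$, $[\delta]=\delta$, $[\langle\nu\rangle\tau]=\nu\to[\tau]$, $[\tau_1\times\cdots\times\tau_n\to\tau]=[\tau_1]\to\cdots\to[\tau_n]\to[\tau]$; atoms become $\lambda$-variables of the same name, function symbols constants. $[a]_\emptyset=a$, $[f(t_1,\dots,t_n)]_\emptyset=f([t_1]_\emptyset,\dots)$, $[a.t]_\emptyset=\lambda a.[t]_\emptyset$, $[\pi\cdot X]_\emptyset=X([\pi\cdot a_1]_\emptyset,\dots,[\pi\cdot a_n]_\emptyset)$ with $X$ a free $\lambda$-variable of type $[\nu_1]\to\cdots\to[\nu_n]\to[\tau]$ ($a_i:\nu_i$, $X:\tau$). $[P]=\{\lambda a_1.\cdots\lambda a_n.[t]_\emptyset\stackrel{?}{=}\lambda a_1.\cdots\lambda a_n.[u]_\emptyset\mid t\stackrel{?}{\approx}u\in P\}$; it is solvable if some $\lambda$-substitution $\theta$ satisfies $\theta(s)=\theta(s')$ modulo $\alpha\beta\eta$ for all its equations.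
   Formalization: Function symbols are required to have a sort (of atoms or data) as result type, not an abstraction type ⟨ν⟩τ; otherwise the claim fails: for c : ⟨ν⟩δ, the problem a.X ≈ c is unsolvable while its translation is solved by X := λx. c x via η. *)

theory Defs
  imports Main
begin

section \<open>Nominal terms\<close>

text \<open>Every sort of atoms has countably many atoms, and every type has countably many variables.\<close>

datatype 's atom = Atom (atom_sort: 's) nat

datatype ('s, 'd) ntype = AtomT 's | DataT 'd | AbsT 's "('s, 'd) ntype"

datatype ('s, 'd) nvar = NVar (nvar_type: "('s, 'd) ntype") nat

text \<open>A permutation \<open>[(a\<^sub>1, b\<^sub>1), \<dots>, (a\<^sub>k, b\<^sub>k)]\<close> is the composition
  \<open>(a\<^sub>1 b\<^sub>1) \<dots> (a\<^sub>k b\<^sub>k)\<close>; the rightmost swapping acts first. That the two atoms of a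
  swapping have the same sort is enforced by the typing rule for suspensions.\<close>

type_synonym 's perm = "('s atom \<times> 's atom) list"

datatype ('s, 'd, 'f) nterm =
    NFun 'f "('s, 'd, 'f) nterm list"
  | NAtom "'s atom"
  | NAbs "'s atom" "('s, 'd, 'f) nterm"
  | NSusp "'s perm" "('s, 'd) nvar"

text \<open>A signature assigns to \<open>f : \<tau>\<^sub>1 \<times> \<dots> \<times> \<tau>\<^sub>n \<rightarrow> \<tau>\<close> the pair
  \<open>([\<tau>\<^sub>1, \<dots>, \<tau>\<^sub>n], \<tau>)\<close>. The result type is a sort, not an abstraction type: with a symbol
  \<open>c : \<langle>\<nu>\<rangle>\<delta>\<close> the equation \<open>a.X \<approx> c\<close> has no nominal solution, whereas its translation
  is solved by \<open>X := \<lambda>a. c a\<close>, using \<open>\<eta>\<close>.\<close>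

type_synonym ('s, 'd, 'f) signat = "'f \<Rightarrow> ('s, 'd) ntype list \<times> ('s, 'd) ntype"

fun is_sort :: "('s, 'd) ntype \<Rightarrow> bool" where
  "is_sort (AtomT \<nu>) = True"
| "is_sort (DataT \<delta>) = True"
| "is_sort (AbsT \<nu> \<tau>) = False"

definition nominal_signature :: "('s, 'd, 'f) signat \<Rightarrow> bool" where
  "nominal_signature sg \<longleftrightarrow> (\<forall>f. is_sort (snd (sg f)))"

inductive ntyped :: "('s, 'd, 'f) signat \<Rightarrow> ('s, 'd, 'f) nterm \<Rightarrow> ('s, 'd) ntype \<Rightarrow> bool"
  for sg where
  "sg f = (\<tau>s, \<tau>) \<Longrightarrow> list_all2 (ntyped sg) ts \<tau>s \<Longrightarrow> ntyped sg (NFun f ts) \<tau>"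
| "ntyped sg (NAtom a) (AtomT (atom_sort a))"
| "ntyped sg t \<tau> \<Longrightarrow> ntyped sg (NAbs a t) (AbsT (atom_sort a) \<tau>)"
| "\<forall>(a, b) \<in> set \<pi>. atom_sort a = atom_sort b \<Longrightarrow> ntyped sg (NSusp \<pi> X) (nvar_type X)"

definition swap_atom :: "'s atom \<times> 's atom \<Rightarrow> 's atom \<Rightarrow> 's atom" where
  "swap_atom ab c = (if c = fst ab then snd ab else if c = snd ab then fst ab else c)"

definition perm_atom :: "'s perm \<Rightarrow> 's atom \<Rightarrow> 's atom" where
  "perm_atom \<pi> c = foldr swap_atom \<pi> c"

fun perm_nterm :: "'s perm \<Rightarrow> ('s, 'd, 'f) nterm \<Rightarrow> ('s, 'd, 'f) nterm" where
  "perm_nterm \<pi> (NFun f ts) = NFun f (map (perm_nterm \<pi>) ts)"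
| "perm_nterm \<pi> (NAtom a) = NAtom (perm_atom \<pi> a)"
| "perm_nterm \<pi> (NAbs a t) = NAbs (perm_atom \<pi> a) (perm_nterm \<pi> t)"
| "perm_nterm \<pi> (NSusp \<pi>' X) = NSusp (\<pi> @ \<pi>') X"

fun nsubst :: "(('s, 'd) nvar \<Rightarrow> ('s, 'd, 'f) nterm) \<Rightarrow> ('s, 'd, 'f) nterm \<Rightarrow> ('s, 'd, 'f) nterm"
  where
  "nsubst \<sigma> (NFun f ts) = NFun f (map (nsubst \<sigma>) ts)"
| "nsubst \<sigma> (NAtom a) = NAtom a"
| "nsubst \<sigma> (NAbs a t) = NAbs a (nsubst \<sigma> t)"
| "nsubst \<sigma> (NSusp \<pi> X) = perm_nterm \<pi> (\<sigma> X)"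

definition nominal_substitution ::
    "('s, 'd, 'f) signat \<Rightarrow> (('s, 'd) nvar \<Rightarrow> ('s, 'd, 'f) nterm) \<Rightarrow> bool" where
  "nominal_substitution sg \<sigma> \<longleftrightarrow>
     finite {X. \<sigma> X \<noteq> NSusp [] X} \<and> (\<forall>X. ntyped sg (\<sigma> X) (nvar_type X))"

type_synonym ('s, 'd) fresh_env = "('s atom \<times> ('s, 'd) nvar) set"

text \<open>The inverse of a sequence of swappings is its reversal.\<close>

inductive fresh :: "('s, 'd) fresh_env \<Rightarrow> 's atom \<Rightarrow> ('s, 'd, 'f) nterm \<Rightarrow> bool"
    ("_ \<turnstile> _ \<sharp> _" [51, 51, 51] 50) for \<Delta> where
  "a \<noteq> a' \<Longrightarrow> \<Delta> \<turnstile> a \<sharp> NAtom a'"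
| "(perm_atom (rev \<pi>) a, X) \<in> \<Delta> \<Longrightarrow> \<Delta> \<turnstile> a \<sharp> NSusp \<pi> X"
| "\<forall>t \<in> set ts. \<Delta> \<turnstile> a \<sharp> t \<Longrightarrow> \<Delta> \<turnstile> a \<sharp> NFun f ts"
| "\<Delta> \<turnstile> a \<sharp> NAbs a t"
| "a \<noteq> a' \<Longrightarrow> \<Delta> \<turnstile> a \<sharp> t \<Longrightarrow> \<Delta> \<turnstile> a \<sharp> NAbs a' t"

inductive nominal_eq ::
    "('s, 'd) fresh_env \<Rightarrow> ('s, 'd, 'f) nterm \<Rightarrow> ('s, 'd, 'f) nterm \<Rightarrow> bool"
    ("_ \<turnstile> _ \<approx> _" [51, 51, 51] 50) for \<Delta> where
  "\<Delta> \<turnstile> NAtom a \<approx> NAtom a"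
| "\<forall>a. perm_atom \<pi> a \<noteq> perm_atom \<pi>' a \<longrightarrow> (a, X) \<in> \<Delta> \<Longrightarrow> \<Delta> \<turnstile> NSusp \<pi> X \<approx> NSusp \<pi>' X"
| "list_all2 (nominal_eq \<Delta>) ts ts' \<Longrightarrow> \<Delta> \<turnstile> NFun f ts \<approx> NFun f ts'"
| "\<Delta> \<turnstile> t \<approx> t' \<Longrightarrow> \<Delta> \<turnstile> NAbs a t \<approx> NAbs a t'"
| "a \<noteq> a' \<Longrightarrow> \<Delta> \<turnstile> t \<approx> perm_nterm [(a, a')] t' \<Longrightarrow> \<Delta> \<turnstile> a \<sharp> t' \<Longrightarrow>
     \<Delta> \<turnstile> NAbs a t \<approx> NAbs a' t'"

type_synonym ('s, 'd, 'f) nproblem = "(('s, 'd, 'f) nterm \<times> ('s, 'd, 'f) nterm) set"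

definition nominal_problem :: "('s, 'd, 'f) signat \<Rightarrow> ('s, 'd, 'f) nproblem \<Rightarrow> bool" where
  "nominal_problem sg P \<longleftrightarrow>
     finite P \<and> (\<forall>(t, u) \<in> P. \<exists>\<tau>. ntyped sg t \<tau> \<and> ntyped sg u \<tau>)"

definition nominal_solvable :: "('s, 'd, 'f) signat \<Rightarrow> ('s, 'd, 'f) nproblem \<Rightarrow> bool" where
  "nominal_solvable sg P \<longleftrightarrow>
     (\<exists>\<Delta> \<sigma>. finite \<Delta> \<and> nominal_substitution sg \<sigma> \<and>
        (\<forall>(t, u) \<in> P. \<Delta> \<turnstile> nsubst \<sigma> t \<approx> nsubst \<sigma> u))"

text \<open>Binders and the atoms of suspended permutations count as occurrences.\<close>

fun nterm_atoms :: "('s, 'd, 'f) nterm \<Rightarrow> 's atom set" where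
  "nterm_atoms (NFun f ts) = (\<Union>t \<in> set ts. nterm_atoms t)"
| "nterm_atoms (NAtom a) = {a}"
| "nterm_atoms (NAbs a t) = insert a (nterm_atoms t)"
| "nterm_atoms (NSusp \<pi> X) = fst ` set \<pi> \<union> snd ` set \<pi>"

definition problem_atoms :: "('s, 'd, 'f) nproblem \<Rightarrow> 's atom set" where
  "problem_atoms P = (\<Union>(t, u) \<in> P. nterm_atoms t \<union> nterm_atoms u)"


section \<open>Simply typed \<open>\<lambda>\<close>-calculus\<close>

datatype ('s, 'd) ltype = AtomB 's | DataB 'd | Fun "('s, 'd) ltype" "('s, 'd) ltype"

text \<open>A \<open>\<lambda>\<close>-variable is a name together with a type, so that there are infinitely many
  variables of each type; variables with the same name and different types are different.\<close>

datatype ('s, 'd) lname = AtomN "'s atom" | UnkN "('s, 'd) nvar"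

type_synonym ('s, 'd) lvar = "('s, 'd) lname \<times> ('s, 'd) ltype"

text \<open>Terms modulo \<open>\<alpha>\<close>: free variables are named, bound variables are de Bruijn indices.\<close>

datatype ('s, 'd, 'f) lterm =
    Bound nat
  | Free "('s, 'd) lvar"
  | Const 'f
  | App "('s, 'd, 'f) lterm" "('s, 'd, 'f) lterm"
  | Abs "('s, 'd) ltype" "('s, 'd, 'f) lterm"

fun trans_type :: "('s, 'd) ntype \<Rightarrow> ('s, 'd) ltype" where
  "trans_type (AtomT \<nu>) = AtomB \<nu>"
| "trans_type (DataT \<delta>) = DataB \<delta>"
| "trans_type (AbsT \<nu> \<tau>) = Fun (AtomB \<nu>) (trans_type \<tau>)"

definition const_type :: "('s, 'd, 'f) signat \<Rightarrow> 'f \<Rightarrow> ('s, 'd) ltype" where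
  "const_type sg f = foldr Fun (map trans_type (fst (sg f))) (trans_type (snd (sg f)))"

text \<open>The list \<open>\<Gamma>\<close> gives the types of the loose bound variables, innermost binder first.\<close>

inductive ltyped ::
    "('s, 'd, 'f) signat \<Rightarrow> ('s, 'd) ltype list \<Rightarrow> ('s, 'd, 'f) lterm \<Rightarrow> ('s, 'd) ltype \<Rightarrow> bool"
  for sg where
  "i < length \<Gamma> \<Longrightarrow> ltyped sg \<Gamma> (Bound i) (\<Gamma> ! i)"
| "ltyped sg \<Gamma> (Free x) (snd x)"
| "ltyped sg \<Gamma> (Const f) (const_type sg f)"
| "ltyped sg \<Gamma> s (Fun T U) \<Longrightarrow> ltyped sg \<Gamma> t T \<Longrightarrow> ltyped sg \<Gamma> (App s t) U"
| "ltyped sg (T # \<Gamma>) s U \<Longrightarrow> ltyped sg \<Gamma> (Abs T s) (Fun T U)"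

fun lift :: "nat \<Rightarrow> ('s, 'd, 'f) lterm \<Rightarrow> ('s, 'd, 'f) lterm" where
  "lift k (Bound i) = Bound (if i < k then i else Suc i)"
| "lift k (Free x) = Free x"
| "lift k (Const f) = Const f"
| "lift k (App s t) = App (lift k s) (lift k t)"
| "lift k (Abs T s) = Abs T (lift (Suc k) s)"

text \<open>\<open>inst k u s\<close> replaces index \<open>k\<close> in \<open>s\<close> by \<open>u\<close> and decrements the greater indices.\<close>

fun inst :: "nat \<Rightarrow> ('s, 'd, 'f) lterm \<Rightarrow> ('s, 'd, 'f) lterm \<Rightarrow> ('s, 'd, 'f) lterm" where
  "inst k u (Bound i) = (if i < k then Bound i else if i = k then u else Bound (i - 1))"
| "inst k u (Free x) = Free x"
| "inst k u (Const f) = Const f"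
| "inst k u (App s t) = App (inst k u s) (inst k u t)"
| "inst k u (Abs T s) = Abs T (inst (Suc k) (lift 0 u) s)"

inductive lambda_eq ::
    "('s, 'd, 'f) signat \<Rightarrow> ('s, 'd) ltype list \<Rightarrow> ('s, 'd, 'f) lterm \<Rightarrow> ('s, 'd, 'f) lterm \<Rightarrow>
     ('s, 'd) ltype \<Rightarrow> bool"
  for sg where
  refl: "ltyped sg \<Gamma> s T \<Longrightarrow> lambda_eq sg \<Gamma> s s T"
| sym: "lambda_eq sg \<Gamma> s t T \<Longrightarrow> lambda_eq sg \<Gamma> t s T"
| trans: "lambda_eq sg \<Gamma> s t T \<Longrightarrow> lambda_eq sg \<Gamma> t u T \<Longrightarrow> lambda_eq sg \<Gamma> s u T"
| app: "lambda_eq sg \<Gamma> s s' (Fun T U) \<Longrightarrow> lambda_eq sg \<Gamma> t t' T \<Longrightarrow>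
     lambda_eq sg \<Gamma> (App s t) (App s' t') U"
| abs: "lambda_eq sg (T # \<Gamma>) s s' U \<Longrightarrow> lambda_eq sg \<Gamma> (Abs T s) (Abs T s') (Fun T U)"
| beta: "ltyped sg (T # \<Gamma>) s U \<Longrightarrow> ltyped sg \<Gamma> t T \<Longrightarrow>
     lambda_eq sg \<Gamma> (App (Abs T s) t) (inst 0 t s) U"
| eta: "ltyped sg \<Gamma> s (Fun T U) \<Longrightarrow>
     lambda_eq sg \<Gamma> (Abs T (App (lift 0 s) (Bound 0))) s (Fun T U)"

text \<open>Going under a binder needs no lifting of \<open>\<theta>\<close>: by typing, the terms \<open>\<theta> x\<close> of a
  \<open>\<lambda>\<close>-substitution have no loose bound variables.\<close>

fun lsubst :: "(('s, 'd) lvar \<Rightarrow> ('s, 'd, 'f) lterm) \<Rightarrow> ('s, 'd, 'f) lterm \<Rightarrow> ('s, 'd, 'f) lterm"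
  where
  "lsubst \<theta> (Bound i) = Bound i"
| "lsubst \<theta> (Free x) = \<theta> x"
| "lsubst \<theta> (Const f) = Const f"
| "lsubst \<theta> (App s t) = App (lsubst \<theta> s) (lsubst \<theta> t)"
| "lsubst \<theta> (Abs T s) = Abs T (lsubst \<theta> s)"

definition lambda_substitution ::
    "('s, 'd, 'f) signat \<Rightarrow> (('s, 'd) lvar \<Rightarrow> ('s, 'd, 'f) lterm) \<Rightarrow> bool" where
  "lambda_substitution sg \<theta> \<longleftrightarrow>
     finite {x. \<theta> x \<noteq> Free x} \<and> (\<forall>x. ltyped sg [] (\<theta> x) (snd x))"

type_synonym ('s, 'd, 'f) lproblem = "(('s, 'd, 'f) lterm \<times> ('s, 'd, 'f) lterm) set"

definition lambda_solvable :: "('s, 'd, 'f) signat \<Rightarrow> ('s, 'd, 'f) lproblem \<Rightarrow> bool" where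
  "lambda_solvable sg Q \<longleftrightarrow>
     (\<exists>\<theta>. lambda_substitution sg \<theta> \<and>
        (\<forall>(s, s') \<in> Q. \<exists>T. lambda_eq sg [] (lsubst \<theta> s) (lsubst \<theta> s') T))"


section \<open>The translation\<close>

text \<open>\<open>bind_var k x s\<close> turns the free variable \<open>x\<close> of a term \<open>s\<close> without loose bound
  variables into the index of the binder outside \<open>s\<close>; \<open>lam x s\<close> is \<open>\<lambda>x. s\<close>.\<close>

fun bind_var :: "nat \<Rightarrow> ('s, 'd) lvar \<Rightarrow> ('s, 'd, 'f) lterm \<Rightarrow> ('s, 'd, 'f) lterm" where
  "bind_var k x (Bound i) = Bound i"
| "bind_var k x (Free y) = (if y = x then Bound k else Free y)"
| "bind_var k x (Const f) = Const f"
| "bind_var k x (App s t) = App (bind_var k x s) (bind_var k x t)"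
| "bind_var k x (Abs T s) = Abs T (bind_var (Suc k) x s)"

definition lam :: "('s, 'd) lvar \<Rightarrow> ('s, 'd, 'f) lterm \<Rightarrow> ('s, 'd, 'f) lterm" where
  "lam x s = Abs (snd x) (bind_var 0 x s)"

definition atom_var :: "'s atom \<Rightarrow> ('s, 'd) lvar" where
  "atom_var a = (AtomN a, AtomB (atom_sort a))"

definition unknown_var :: "'s atom list \<Rightarrow> ('s, 'd) nvar \<Rightarrow> ('s, 'd) lvar" where
  "unknown_var as X =
     (UnkN X, foldr Fun (map (\<lambda>a. AtomB (atom_sort a)) as) (trans_type (nvar_type X)))"

fun trans_term :: "'s atom list \<Rightarrow> ('s, 'd, 'f) nterm \<Rightarrow> ('s, 'd, 'f) lterm" where
  "trans_term as (NFun f ts) = foldl App (Const f) (map (trans_term as) ts)"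
| "trans_term as (NAtom a) = Free (atom_var a)"
| "trans_term as (NAbs a t) = lam (atom_var a) (trans_term as t)"
| "trans_term as (NSusp \<pi> X) =
     foldl App (Free (unknown_var as X)) (map (\<lambda>a. Free (atom_var (perm_atom \<pi> a))) as)"

definition close_term :: "'s atom list \<Rightarrow> ('s, 'd, 'f) nterm \<Rightarrow> ('s, 'd, 'f) lterm" where
  "close_term as t = foldr (\<lambda>a. lam (atom_var a)) as (trans_term as t)"

definition trans_problem :: "'s atom list \<Rightarrow> ('s, 'd, 'f) nproblem \<Rightarrow> ('s, 'd, 'f) lproblem" where
  "trans_problem as P = {(close_term as t, close_term as u) | t u. (t, u) \<in> P}"

end

theory Submission
  imports Defs
begin

text \<open>
  Let \<open>\<theta>\<close> solve the translated problem. Replacing every free variable of type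
  \<open>T\<^sub>1 \<rightarrow> \<dots> \<rightarrow> T\<^sub>k \<rightarrow> B\<close> in the range of \<open>\<theta>\<close> by the constant function with value \<open>z\<^sub>B\<close>, for a
  fixed unknown \<open>z\<^sub>B\<close> of base type \<open>B\<close>, keeps it a solution. Then the \<open>\<eta>\<close>-long normal form of
  \<open>\<theta>(X)(a\<^sub>1, \<dots>, a\<^sub>n)\<close> is built from atoms, applied function symbols, abstractions over atoms and
  the \<open>z\<^sub>B\<close>, that is, it is \<open>trans_term []\<close> of a nominal term, which is taken as \<open>\<sigma>(X)\<close>. As the
  range of \<open>\<theta>\<close> contains no atoms, normal forms commute with permutations of atoms, so that
  the translation of \<open>t\<close> under \<open>\<theta>\<close> has the normal form \<open>trans_term [] (\<sigma>(t))\<close>. Two nominal terms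
  with the same image under \<open>trans_term []\<close> are nominally equal once all atoms in sight are
  fresh for all unknowns.

  Existence of normal forms and their invariance under \<open>\<beta>\<eta>\<close> follow from a logical relation on
  locally closed terms; at base type it says that both terms have a common normal form.
\<close>

section \<open>Locally closed terms\<close>

fun lc_at :: "nat \<Rightarrow> ('s, 'd, 'f) lterm \<Rightarrow> bool" where
  "lc_at k (Bound i) = (i < k)"
| "lc_at k (Free x) = True"
| "lc_at k (Const f) = True"
| "lc_at k (App s t) = (lc_at k s \<and> lc_at k t)"
| "lc_at k (Abs T s) = lc_at (Suc k) s"

abbreviation lc :: "('s, 'd, 'f) lterm \<Rightarrow> bool" where
  "lc \<equiv> lc_at 0"

lemma lc_at_mono: "lc_at k s \<Longrightarrow> k \<le> l \<Longrightarrow> lc_at l s"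
  by (induction s arbitrary: k l) force+

lemma lift_lc_at: "lc_at k s \<Longrightarrow> lift k s = s"
  by (induction s arbitrary: k) auto

lemma inst_lc_at: "lc_at k s \<Longrightarrow> inst k u s = s"
  by (induction s arbitrary: k u) auto

lemma lift_lc: "lc s \<Longrightarrow> lift k s = s"
  by (rule lift_lc_at) (auto intro: lc_at_mono)

lemma inst_lc: "lc s \<Longrightarrow> inst k u s = s"
  by (rule inst_lc_at) (auto intro: lc_at_mono)

lemma lc_at_foldl_App: "lc_at k (foldl App s ts) \<longleftrightarrow> lc_at k s \<and> (\<forall>t \<in> set ts. lc_at k t)"
  by (induction ts arbitrary: s) auto

lemma lc_at_bind_var: "lc_at k s \<Longrightarrow> lc_at (Suc k) (bind_var k x s)"
  by (induction s arbitrary: k) auto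

lemma lc_lam: "lc s \<Longrightarrow> lc (lam x s)"
  by (simp add: lam_def lc_at_bind_var)

text \<open>Local closure at \<open>k\<close> means that every \<open>Bound k\<close> created at
  this level comes from \<open>x\<close>, so opening with \<open>x\<close> undoes the
  abstraction.\<close>

lemma inst_bind_var: "lc_at k s \<Longrightarrow> inst k (Free x) (bind_var k x s) = s"
  by (induction s arbitrary: k) auto

section \<open>Free variables and application spines\<close>

fun lfree :: "('s, 'd, 'f) lterm \<Rightarrow> ('s, 'd) lvar set" where
  "lfree (Bound i) = {}"
| "lfree (Free x) = {x}"
| "lfree (Const f) = {}"
| "lfree (App s t) = lfree s \<union> lfree t"
| "lfree (Abs T s) = lfree s"

lemma finite_lfree: "finite (lfree s)"
  by (induction s) auto

lemma lfree_lift: "lfree (lift k s) = lfree s"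
  by (induction s arbitrary: k) auto

lemma lfree_inst: "lfree (inst k u s) \<subseteq> lfree s \<union> lfree u"
  by (induction s arbitrary: k u) (auto simp: lfree_lift, (fastforce simp: lfree_lift)+)

lemma lfree_bind_var: "lfree (bind_var k x s) = lfree s - {x}"
  by (induction s arbitrary: k) auto

lemma lfree_lam: "lfree (lam x s) = lfree s - {x}"
  by (simp add: lam_def lfree_bind_var)

lemma bind_var_not_free: "x \<notin> lfree s \<Longrightarrow> bind_var k x s = s"
  by (induction s arbitrary: k) auto

lemma lfree_foldl_App: "lfree (foldl App s ts) = lfree s \<union> (\<Union>t \<in> set ts. lfree t)"
  by (induction ts arbitrary: s) auto

lemma foldl_App_Const_inject:
  "foldl App (Const f) ss = foldl App (Const g) ts \<longleftrightarrow> f = g \<and> ss = ts"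
proof (induction ss arbitrary: ts rule: rev_induct)
  case Nil
  show ?case by (cases ts rule: rev_cases) auto
next
  case (snoc s ss)
  then show ?case by (cases ts rule: rev_cases) auto
qed

lemma foldl_App_Const_neq [simp]:
  "foldl App (Const f) ss \<noteq> Free x" "foldl App (Const f) ss \<noteq> Abs T s"
  "Free x \<noteq> foldl App (Const f) ss" "Abs T s \<noteq> foldl App (Const f) ss"
  by (cases ss rule: rev_cases; simp)+

section \<open>Substitution and renaming of atoms\<close>

lemma lsubst_foldl_App: "lsubst \<theta> (foldl App s ts) = foldl App (lsubst \<theta> s) (map (lsubst \<theta>) ts)"
  by (induction ts arbitrary: s) auto

lemma lsubst_lsubst: "lsubst \<rho> (lsubst \<theta> s) = lsubst (\<lambda>x. lsubst \<rho> (\<theta> x)) s"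
  by (induction s) auto

lemma lsubst_id: "(\<And>x. x \<in> lfree s \<Longrightarrow> \<theta> x = Free x) \<Longrightarrow> lsubst \<theta> s = s"
  by (induction s) auto

lemma lfree_lsubst: "lfree (lsubst \<theta> s) = (\<Union>x \<in> lfree s. lfree (\<theta> x))"
  by (induction s) auto

lemma lc_at_lsubst: "(\<And>x. lc (\<theta> x)) \<Longrightarrow> lc_at k s \<Longrightarrow> lc_at k (lsubst \<theta> s)"
  by (induction s arbitrary: k) (auto intro: lc_at_mono)

lemma lsubst_lift: "(\<And>x. lc (\<theta> x)) \<Longrightarrow> lsubst \<theta> (lift k s) = lift k (lsubst \<theta> s)"
  by (induction s arbitrary: k) (auto simp: lift_lc)

lemma lsubst_inst:
  "(\<And>x. lc (\<theta> x)) \<Longrightarrow> lsubst \<theta> (inst k u s) = inst k (lsubst \<theta> u) (lsubst \<theta> s)"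
  by (induction s arbitrary: k u) (auto simp: inst_lc lsubst_lift)

text \<open>Below its binder \<open>x\<close> is no longer substituted, hence the update of
  \<open>\<theta>\<close>. The assumption keeps the images of other variables from being
  captured.\<close>

lemma lsubst_bind_var:
  assumes "\<And>y. y \<noteq> x \<Longrightarrow> x \<notin> lfree (\<theta> y)"
  shows "lsubst \<theta> (bind_var k x s) = bind_var k x (lsubst (\<theta>(x := Free x)) s)"
  using assms by (induction s arbitrary: k) (auto simp: bind_var_not_free)

lemma lsubst_lam:
  assumes "\<And>y. y \<noteq> x \<Longrightarrow> x \<notin> lfree (\<theta> y)"
  shows "lsubst \<theta> (lam x s) = lam x (lsubst (\<theta>(x := Free x)) s)"
  using lsubst_bind_var[OF assms] by (simp add: lam_def)

section \<open>Permutations of atoms and the renamings they induce on free variables\<close>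

lemma perm_atom_Nil [simp]: "perm_atom [] a = a"
  by (simp add: perm_atom_def)

lemma perm_atom_Cons: "perm_atom (ab # \<pi>) a = swap_atom ab (perm_atom \<pi> a)"
  by (simp add: perm_atom_def)

lemma swap_atom_swap_atom [simp]: "swap_atom ab (swap_atom ab c) = c"
  by (auto simp: swap_atom_def)

lemma swap_atom_inject [simp]: "swap_atom ab c = swap_atom ab d \<longleftrightarrow> c = d"
  by (metis swap_atom_swap_atom)

lemma perm_atom_inject [simp]: "perm_atom \<pi> a = perm_atom \<pi> b \<longleftrightarrow> a = b"
  by (induction \<pi>) (auto simp: perm_atom_Cons)

definition sorted_perm :: "'s perm \<Rightarrow> bool" where
  "sorted_perm \<pi> \<longleftrightarrow> (\<forall>(a, b) \<in> set \<pi>. atom_sort a = atom_sort b)"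

lemma atom_sort_perm_atom: "sorted_perm \<pi> \<Longrightarrow> atom_sort (perm_atom \<pi> a) = atom_sort a"
  by (induction \<pi>) (auto simp: sorted_perm_def perm_atom_Cons swap_atom_def)

lemma perm_atom_closed:
  "fst ` set \<pi> \<union> snd ` set \<pi> \<subseteq> A \<Longrightarrow> perm_atom \<pi> a \<in> A \<longleftrightarrow> a \<in> A"
  by (induction \<pi>) (auto simp: perm_atom_Cons swap_atom_def)

lemma perm_atom_fixed: "fst ` set \<pi> \<union> snd ` set \<pi> \<subseteq> A \<Longrightarrow> a \<notin> A \<Longrightarrow> perm_atom \<pi> a = a"
  by (induction \<pi>) (auto simp: perm_atom_Cons swap_atom_def)

text \<open>A name \<open>AtomN a\<close> paired with another type than that of \<open>a\<close> does not stand for an atom,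
  so it must stay fixed.\<close>

definition perm_lvar :: "'s perm \<Rightarrow> ('s, 'd) lvar \<Rightarrow> ('s, 'd) lvar" where
  "perm_lvar \<pi> x = (case x of
     (AtomN a, T) \<Rightarrow> if T = AtomB (atom_sort a) then (AtomN (perm_atom \<pi> a), T) else x
   | _ \<Rightarrow> x)"

lemma perm_lvar_inject:
  assumes "sorted_perm \<pi>"
  shows "perm_lvar \<pi> x = perm_lvar \<pi> y \<longleftrightarrow> x = y"
  using atom_sort_perm_atom[OF assms]
  by (cases x; cases y) (auto simp: perm_lvar_def split: lname.splits if_splits)

lemma snd_perm_lvar: "snd (perm_lvar \<pi> x) = snd x"
  by (auto simp: perm_lvar_def split: lname.splits prod.splits)

lemma perm_lvar_atom_var: "sorted_perm \<pi> \<Longrightarrow> perm_lvar \<pi> (atom_var a) = atom_var (perm_atom \<pi> a)"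
  by (simp add: perm_lvar_def atom_var_def atom_sort_perm_atom)

lemma perm_lvar_unknown_var [simp]: "perm_lvar \<pi> (unknown_var as X) = unknown_var as X"
  by (simp add: perm_lvar_def unknown_var_def)

lemma atom_var_inject [simp]: "atom_var a = atom_var b \<longleftrightarrow> a = b"
  by (auto simp: atom_var_def)

lemma atom_var_neq_unknown_var [simp]:
  "atom_var a \<noteq> unknown_var as X" "unknown_var as X \<noteq> atom_var a"
  by (auto simp: atom_var_def unknown_var_def)

lemma unknown_var_inject [simp]: "unknown_var as X = unknown_var as Y \<longleftrightarrow> X = Y"
  by (auto simp: unknown_var_def)

lemma snd_atom_var [simp]: "snd (atom_var a) = AtomB (atom_sort a)"
  by (simp add: atom_var_def)

abbreviation rename :: "'s perm \<Rightarrow> ('s, 'd, 'f) lterm \<Rightarrow> ('s, 'd, 'f) lterm" where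
  "rename \<pi> \<equiv> lsubst (\<lambda>x. Free (perm_lvar \<pi> x))"

text \<open>A renaming may send another variable to \<open>x\<close>, so
  \<open>lsubst_bind_var\<close> does not cover this case; injectivity of
  \<open>perm_lvar \<pi>\<close> prevents capture.\<close>

lemma rename_bind_var:
  "sorted_perm \<pi> \<Longrightarrow> rename \<pi> (bind_var k x s) = bind_var k (perm_lvar \<pi> x) (rename \<pi> s)"
  by (induction s arbitrary: k) (auto simp: perm_lvar_inject)

lemma rename_lam: "sorted_perm \<pi> \<Longrightarrow> rename \<pi> (lam x s) = lam (perm_lvar \<pi> x) (rename \<pi> s)"
  by (simp add: lam_def rename_bind_var snd_perm_lvar)

lemma rename_inst: "rename \<pi> (inst k u s) = inst k (rename \<pi> u) (rename \<pi> s)"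
  by (rule lsubst_inst) simp

lemma atom_var_in_lfree_rename:
  assumes "sorted_perm \<pi>"
  shows "atom_var (perm_atom \<pi> a) \<in> lfree (rename \<pi> s) \<longleftrightarrow> atom_var a \<in> lfree s"
  using assms by (auto simp: lfree_lsubst perm_lvar_inject simp flip: perm_lvar_atom_var)

lemma rename_no_atoms: "(\<And>a. atom_var a \<notin> lfree s) \<Longrightarrow> rename \<pi> s = s"
proof (rule lsubst_id)
  fix x assume *: "\<And>a. atom_var a \<notin> lfree s" "x \<in> lfree s"
  then have "x \<noteq> atom_var a" for a by blast
  then show "Free (perm_lvar \<pi> x) = Free x"
    by (auto simp: perm_lvar_def atom_var_def split: lname.splits prod.splits)
qed

lemma sorted_swap: "atom_sort a = atom_sort b \<Longrightarrow> sorted_perm [(a, b)]"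
  by (simp add: sorted_perm_def)

lemma perm_atom_swap [simp]:
  "perm_atom [(a, b)] a = b" "perm_atom [(a, b)] b = a"
  by (auto simp: perm_atom_Cons swap_atom_def)

lemma rename_swap_fresh:
  assumes "atom_var a \<notin> lfree s" "atom_var b \<notin> lfree s"
  shows "rename [(a, b)] s = s"
proof (rule lsubst_id)
  fix x assume "x \<in> lfree s"
  with assms have "x \<noteq> atom_var a" "x \<noteq> atom_var b" by auto
  then show "Free (perm_lvar [(a, b)] x) = Free x"
    by (auto simp: perm_lvar_def atom_var_def perm_atom_Cons swap_atom_def
        split: lname.splits prod.splits)
qed

text \<open>This is \<alpha>-renaming: neither \<open>a\<close> nor \<open>b\<close> is free in the
  abstracted term, so the swap fixes it, while equivariance moves the swap inside.\<close>

lemma bind_var_rename_swap: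
  assumes "atom_sort a = atom_sort b" "a \<noteq> b" "atom_var b \<notin> lfree s"
  shows "bind_var k (atom_var b) (rename [(a, b)] s) = bind_var k (atom_var a) s"
proof -
  have "rename [(a, b)] (bind_var k (atom_var a) s)
      = bind_var k (atom_var b) (rename [(a, b)] s)"
    using sorted_swap[OF assms(1)] by (simp add: rename_bind_var perm_lvar_atom_var)
  moreover have "rename [(a, b)] (bind_var k (atom_var a) s) = bind_var k (atom_var a) s"
    using assms(3) by (intro rename_swap_fresh) (auto simp: lfree_bind_var)
  ultimately show ?thesis by simp
qed

lemma lam_rename_swap:
  assumes "atom_sort a = atom_sort b" "a \<noteq> b" "atom_var b \<notin> lfree s"
  shows "lam (atom_var b) (rename [(a, b)] s) = lam (atom_var a) s"
  using bind_var_rename_swap[OF assms] assms(1) by (simp add: lam_def)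

text \<open>The conclusions match the freshness and swapping premises of the nominal rule for
  abstractions with different binders.\<close>

lemma lam_atom_var_eqD:
  assumes eq: "lam (atom_var a) s = lam (atom_var b) t" and "a \<noteq> b" and lc: "lc s" "lc t"
  shows "atom_sort a = atom_sort b" "atom_var a \<notin> lfree t" "s = rename [(a, b)] t"
proof -
  show sort: "atom_sort a = atom_sort b" using eq by (simp add: lam_def)
  have "atom_var a \<notin> lfree (lam (atom_var b) t)"
    unfolding eq[symmetric] by (simp add: lfree_lam)
  then show fresh: "atom_var a \<notin> lfree t" using \<open>a \<noteq> b\<close> by (simp add: lfree_lam)
  \<comment> \<open>The two lists denote the same swap; the reversed one fits
    \<open>bind_var_rename_swap\<close> with the roles of the atoms exchanged.\<close>
  have swap: "rename [(a, b)] t = rename [(b, a)] t"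
    by (intro arg_cong[of _ _ "\<lambda>\<theta>. lsubst \<theta> t"] ext)
      (auto simp: perm_lvar_def perm_atom_Cons swap_atom_def split: prod.split lname.split)
  have "bind_var 0 (atom_var a) (rename [(b, a)] t) = bind_var 0 (atom_var a) s"
    using bind_var_rename_swap[of b a t] sort fresh \<open>a \<noteq> b\<close> eq by (simp add: lam_def)
  \<comment> \<open>Opening both bodies with \<open>a\<close> recovers the locally closed
    terms.\<close>
  then have "inst 0 (Free (atom_var a)) (bind_var 0 (atom_var a) (rename [(b, a)] t))
      = inst 0 (Free (atom_var a)) (bind_var 0 (atom_var a) s)" by simp
  then show "s = rename [(a, b)] t"
    using lc by (simp add: inst_bind_var lc_at_lsubst swap)
qed

lemma ex_fresh_atom:
  assumes "finite W"
  shows "\<exists>a. atom_sort a = \<nu> \<and> a \<noteq> b \<and> atom_var a \<notin> W"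
proof -
  have "inj (\<lambda>n. atom_var (Atom \<nu> n))" by (auto intro: injI)
  then have "infinite (range (\<lambda>n. atom_var (Atom \<nu> n)))"
    using finite_imageD infinite_UNIV_nat by blast
  then obtain n where "atom_var (Atom \<nu> n) \<notin> insert (atom_var b) W"
    using assms by (metis finite.insertI finite_subset image_subsetI)
  then show ?thesis by (intro exI[of _ "Atom \<nu> n"]) auto
qed

section \<open>Typing\<close>

inductive_cases ltyped_BoundE: "ltyped sg \<Gamma> (Bound i) T"
inductive_cases ltyped_FreeE: "ltyped sg \<Gamma> (Free x) T"
inductive_cases ltyped_ConstE: "ltyped sg \<Gamma> (Const f) T"
inductive_cases ltyped_AppE: "ltyped sg \<Gamma> (App s t) T"
inductive_cases ltyped_AbsE: "ltyped sg \<Gamma> (Abs U s) T"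

lemma ltyped_unique: "ltyped sg \<Gamma> s T \<Longrightarrow> ltyped sg \<Gamma> s U \<Longrightarrow> T = U"
proof (induction arbitrary: U rule: ltyped.induct)
  case (4 \<Gamma> s T U t)
  then show ?case by (metis ltyped_AppE ltype.inject(3))
next
  case (5 T \<Gamma> s U)
  then show ?case by (metis ltyped_AbsE)
qed (auto elim: ltyped_BoundE ltyped_FreeE ltyped_ConstE)

lemma lc_at_ltyped: "ltyped sg \<Gamma> s T \<Longrightarrow> lc_at (length \<Gamma>) s"
  by (induction rule: ltyped.induct) auto

lemma ltyped_weaken: "ltyped sg \<Gamma> s T \<Longrightarrow> ltyped sg (\<Gamma> @ \<Gamma>') s T"
proof (induction rule: ltyped.induct)
  case (1 i \<Gamma>)
  then show ?case using ltyped.intros(1)[of i "\<Gamma> @ \<Gamma>'"] by (simp add: nth_append)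
qed (auto intro: ltyped.intros)

lemma ltyped_lift:
  "ltyped sg \<Gamma> s T \<Longrightarrow> \<Gamma> = \<Gamma>1 @ \<Gamma>2 \<Longrightarrow> ltyped sg (\<Gamma>1 @ U # \<Gamma>2) (lift (length \<Gamma>1) s) T"
proof (induction arbitrary: \<Gamma>1 rule: ltyped.induct)
  case (1 i \<Gamma>)
  then show ?case
    using ltyped.intros(1)[of i "\<Gamma>1 @ U # \<Gamma>2"] ltyped.intros(1)[of "Suc i" "\<Gamma>1 @ U # \<Gamma>2"]
    by (auto simp: nth_append Suc_diff_le)
next
  case (5 T \<Gamma> s V)
  then show ?case using "5.IH"[of "T # \<Gamma>1"] by (auto intro: ltyped.intros)
qed (auto intro: ltyped.intros)

lemma ltyped_inst:
  "ltyped sg \<Gamma> s T \<Longrightarrow> \<Gamma> = \<Gamma>1 @ U # \<Gamma>2 \<Longrightarrow> ltyped sg (\<Gamma>1 @ \<Gamma>2) u U \<Longrightarrow>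
   ltyped sg (\<Gamma>1 @ \<Gamma>2) (inst (length \<Gamma>1) u s) T"
proof (induction arbitrary: \<Gamma>1 u rule: ltyped.induct)
  case (1 i \<Gamma>)
  then show ?case
    using ltyped.intros(1)[of i "\<Gamma>1 @ \<Gamma>2" sg] ltyped.intros(1)[of "i - 1" "\<Gamma>1 @ \<Gamma>2" sg]
    by (cases i) (auto simp: nth_append nth_Cons' Suc_diff_le split: if_splits)
next
  case (5 T \<Gamma> s V)
  then show ?case
    using "5.IH"[of "T # \<Gamma>1" "lift 0 u"] ltyped_lift[of sg "\<Gamma>1 @ \<Gamma>2" u U "[]" _ T]
    by (auto intro: ltyped.intros)
next
  case (4 \<Gamma> s T V t)
  then show ?case using ltyped.intros(4) by fastforce
qed (auto intro: ltyped.intros)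

lemma lambda_eq_ltyped: "lambda_eq sg \<Gamma> s t T \<Longrightarrow> ltyped sg \<Gamma> s T \<and> ltyped sg \<Gamma> t T"
proof (induction rule: lambda_eq.induct)
  case (beta T \<Gamma> s U t)
  then show ?case
    using ltyped_inst[of sg "T # \<Gamma>" s U "[]" T \<Gamma> t] by (auto intro: ltyped.intros)
next
  case (eta \<Gamma> s T U)
  then have "ltyped sg (T # \<Gamma>) (lift 0 s) (Fun T U)"
    using ltyped_lift[of sg \<Gamma> s "Fun T U" "[]" \<Gamma> T] by simp
  moreover have "ltyped sg (T # \<Gamma>) (Bound 0) T"
    using ltyped.intros(1)[of 0 "T # \<Gamma>"] by simp
  ultimately show ?case using eta by (auto intro: ltyped.intros)
qed (auto intro: ltyped.intros)

lemma ltyped_lsubst: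
  assumes "\<And>x. ltyped sg [] (\<theta> x) (snd x)"
  shows "ltyped sg \<Gamma> s T \<Longrightarrow> ltyped sg \<Gamma> (lsubst \<theta> s) T"
proof (induction rule: ltyped.induct)
  case (2 \<Gamma> x)
  then show ?case using ltyped_weaken[OF assms, of \<Gamma> x] by simp
qed (auto intro: ltyped.intros)

text \<open>The new binder lies outside all others, so its type goes to the end of the context and
  its index is \<open>length \<Gamma>\<close>.\<close>

lemma ltyped_bind_var:
  "ltyped sg \<Gamma> s T \<Longrightarrow> ltyped sg (\<Gamma> @ [snd x]) (bind_var (length \<Gamma>) x s) T"
proof (induction rule: ltyped.induct)
  case (1 i \<Gamma>)
  then show ?case using ltyped.intros(1)[of i "\<Gamma> @ [snd x]"] by (simp add: nth_append)
next
  case (2 \<Gamma> y)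
  then show ?case
    using ltyped.intros(1)[of "length \<Gamma>" "\<Gamma> @ [snd x]"] by (auto intro: ltyped.intros)
qed (auto intro: ltyped.intros)

lemma ltyped_lam: "ltyped sg [] s T \<Longrightarrow> ltyped sg [] (lam x s) (Fun (snd x) T)"
  using ltyped_bind_var[of sg "[]" s T x] by (auto simp: lam_def intro: ltyped.intros)

lemma ltyped_foldl_App:
  "ltyped sg \<Gamma> s (foldr Fun Ts T) \<Longrightarrow> list_all2 (ltyped sg \<Gamma>) ts Ts \<Longrightarrow>
   ltyped sg \<Gamma> (foldl App s ts) T"
proof (induction ts arbitrary: s Ts)
  case (Cons t ts)
  then show ?case by (cases Ts) (auto intro: ltyped.intros)
qed auto

lemma ltyped_trans_term: "ntyped sg t \<tau> \<Longrightarrow> ltyped sg [] (trans_term as t) (trans_type \<tau>)"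
proof (induction rule: ntyped.induct)
  case (1 f \<tau>s \<tau> ts)
  have "ltyped sg [] (Const f) (foldr Fun (map trans_type \<tau>s) (trans_type \<tau>))"
    using ltyped.intros(3)[of sg "[]" f] 1(1) by (simp add: const_type_def)
  moreover have "list_all2 (ltyped sg []) (map (trans_term as) ts) (map trans_type \<tau>s)"
    using 1(2) by (auto simp: list.rel_map elim: list_all2_mono)
  ultimately show ?case by (simp add: ltyped_foldl_App)
next
  case (2 a)
  then show ?case using ltyped.intros(2)[of sg "[]" "atom_var a"] by simp
next
  case (3 t \<tau> a)
  then show ?case using ltyped_lam[of sg _ _ "atom_var a"] by simp
next
  case (4 \<pi> X)
  then have sp: "sorted_perm \<pi>" by (simp add: sorted_perm_def)
  have "ltyped sg [] (Free (unknown_var as X))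
      (foldr Fun (map (\<lambda>a. AtomB (atom_sort a)) as) (trans_type (nvar_type X)))"
    using ltyped.intros(2)[of sg "[]" "unknown_var as X"] by (simp add: unknown_var_def)
  moreover have "ltyped sg [] (Free (atom_var (perm_atom \<pi> a))) (AtomB (atom_sort a))" for a
    using ltyped.intros(2)[of sg "[]" "atom_var (perm_atom \<pi> a)"] atom_sort_perm_atom[OF sp]
    by simp
  then have "list_all2 (ltyped sg []) (map (\<lambda>a. Free (atom_var (perm_atom \<pi> a))) as)
      (map (\<lambda>a. AtomB (atom_sort a)) as)"
    by (simp add: list.rel_map list_all2_same)
  ultimately show ?case by (simp add: ltyped_foldl_App)
qed

lemma ltyped_close_term:
  assumes "ntyped sg t \<tau>"
  shows "ltyped sg [] (close_term as t)
    (foldr Fun (map (\<lambda>a. AtomB (atom_sort a)) as) (trans_type \<tau>))"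
proof -
  have "ltyped sg [] (foldr (\<lambda>a. lam (atom_var a)) bs s)
      (foldr Fun (map (\<lambda>a. AtomB (atom_sort a)) bs) T)" if "ltyped sg [] s T" for bs s T
    using that
  proof (induction bs)
    case (Cons b bs)
    then show ?case using ltyped_lam[of sg _ _ "atom_var b"] by simp
  qed simp
  then show ?thesis using ltyped_trans_term[OF assms] by (simp add: close_term_def)
qed

section \<open>Type-directed normal forms\<close>

text \<open>Weak head reduction: nothing is contracted in arguments or under abstractions, which
  makes the relation deterministic.\<close>

inductive wh :: "('s, 'd, 'f) lterm \<Rightarrow> ('s, 'd, 'f) lterm \<Rightarrow> bool" where
  wh_beta: "wh (App (Abs T s) t) (inst 0 t s)"
| wh_app: "wh s s' \<Longrightarrow> wh (App s t) (App s' t)"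

inductive_cases wh_AppE: "wh (App s t) u"
inductive_cases wh_AbsE [elim!]: "wh (Abs T s) u"
inductive_cases wh_FreeE [elim!]: "wh (Free x) u"
inductive_cases wh_ConstE [elim!]: "wh (Const f) u"

lemma wh_deterministic: "wh s t \<Longrightarrow> wh s u \<Longrightarrow> t = u"
proof (induction arbitrary: u rule: wh.induct)
  case (wh_beta T s t)
  then show ?case by (auto elim: wh_AppE)
next
  case (wh_app s s' t)
  from wh_app.prems show ?case
  proof (rule wh_AppE)
    fix T s0 assume "s = Abs T s0"
    then show ?thesis using wh_app.hyps by blast
  next
    fix s'' assume "u = App s'' t" "wh s s''"
    then show ?thesis using wh_app.IH[of s''] by simp
  qed
qed

lemma not_wh_Const_spine: "\<not> wh (foldl App (Const f) ss) t"
proof (induction ss arbitrary: t rule: rev_induct)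
  case (snoc s ss)
  then show ?case by (auto elim!: wh_AppE)
qed auto

lemma wh_lfree: "wh s t \<Longrightarrow> lfree t \<subseteq> lfree s"
  by (induction rule: wh.induct) (use lfree_inst in fastforce)+

lemma wh_rename: "wh s t \<Longrightarrow> wh (rename \<pi> s) (rename \<pi> t)"
  by (induction rule: wh.induct) (auto simp: rename_inst intro: wh.intros)

lemma wh_lam: "lc s \<Longrightarrow> wh (App (lam x s) (Free x)) s"
  using wh_beta[of "snd x" "bind_var 0 x s" "Free x"] by (simp add: lam_def inst_bind_var)

text \<open>\<open>nf sg \<tau> s n\<close> holds if \<open>n\<close> is the \<open>\<eta>\<close>-long \<open>\<beta>\<close>-normal form of \<open>s\<close> at type \<open>\<tau>\<close>. It covers
  only terms whose free variables are atoms or the unknowns \<open>NVar \<tau> 0\<close> of base type,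
  which is why no neutral terms other than applied constants arise.\<close>

inductive nf ::
    "('s, 'd, 'f) signat \<Rightarrow> ('s, 'd) ntype \<Rightarrow> ('s, 'd, 'f) lterm \<Rightarrow> ('s, 'd, 'f) lterm \<Rightarrow> bool"
  for sg where
  nf_atom: "nf sg (AtomT (atom_sort a)) (Free (atom_var a)) (Free (atom_var a))"
| nf_unknown: "is_sort \<tau> \<Longrightarrow>
     nf sg \<tau> (Free (unknown_var [] (NVar \<tau> 0))) (Free (unknown_var [] (NVar \<tau> 0)))"
| nf_const: "sg f = (\<tau>s, \<tau>) \<Longrightarrow> is_sort \<tau> \<Longrightarrow> length ss = length \<tau>s \<Longrightarrow> length ns = length \<tau>s \<Longrightarrow>
     \<forall>i < length \<tau>s. nf sg (\<tau>s ! i) (ss ! i) (ns ! i) \<Longrightarrow>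
     nf sg \<tau> (foldl App (Const f) ss) (foldl App (Const f) ns)"
| nf_step: "is_sort \<tau> \<Longrightarrow> wh s s' \<Longrightarrow> nf sg \<tau> s' n \<Longrightarrow> nf sg \<tau> s n"
| nf_abs: "atom_var a \<notin> lfree s \<Longrightarrow> nf sg \<tau> (App s (Free (atom_var a))) n \<Longrightarrow>
     nf sg (AbsT (atom_sort a) \<tau>) s (lam (atom_var a) n)"

lemma nf_AbsTE:
  assumes "nf sg (AbsT \<nu> \<tau>) s n"
  obtains a m where "atom_sort a = \<nu>" "n = lam (atom_var a) m" "atom_var a \<notin> lfree s"
    "nf sg \<tau> (App s (Free (atom_var a))) m"
  using assms by (cases rule: nf.cases) simp_all

lemma nf_lfree: "nf sg \<tau> s n \<Longrightarrow> lfree n \<subseteq> lfree s"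
proof (induction rule: nf.induct)
  case (nf_const f \<tau>s \<tau> ss ns)
  then show ?case by (fastforce simp: lfree_foldl_App in_set_conv_nth)
next
  case (nf_step \<tau> s s' n)
  then show ?case using wh_lfree by blast
next
  case (nf_abs a s \<tau> n)
  then show ?case by (auto simp: lfree_lam)
qed auto

text \<open>Equivariance of normal forms, which later accounts for suspended permutations. The
  unknowns of base type are fixed by every renaming.\<close>

lemma nf_rename:
  assumes "sorted_perm \<pi>"
  shows "nf sg \<tau> s n \<Longrightarrow> nf sg \<tau> (rename \<pi> s) (rename \<pi> n)"
proof (induction rule: nf.induct)
  case (nf_atom a)
  then show ?case
    using nf.nf_atom[of sg "perm_atom \<pi> a"] assms
    by (simp add: perm_lvar_atom_var atom_sort_perm_atom)
next
  case (nf_unknown \<tau>)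
  then show ?case using nf.nf_unknown by simp
next
  case (nf_const f \<tau>s \<tau> ss ns)
  then show ?case by (auto simp: lsubst_foldl_App intro!: nf.nf_const)
next
  case (nf_step \<tau> s s' n)
  then show ?case by (auto intro: nf.nf_step wh_rename)
next
  case (nf_abs a s \<tau> n)
  then show ?case
    using nf.nf_abs[of "perm_atom \<pi> a" "rename \<pi> s" sg \<tau> "rename \<pi> n"] assms
    by (simp add: perm_lvar_atom_var atom_sort_perm_atom rename_lam atom_var_in_lfree_rename)
qed

text \<open>Changes the atom used for \<eta>-expansion: neither atom is free in \<open>s\<close>, so
  the swap fixes \<open>s\<close> and moves only the argument.\<close>

lemma nf_swap:
  assumes "nf sg \<tau> (App s (Free (atom_var a))) n" "atom_sort a = atom_sort b"
    and "atom_var a \<notin> lfree s" "atom_var b \<notin> lfree s"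
  shows "nf sg \<tau> (App s (Free (atom_var b))) (rename [(a, b)] n)"
  using nf_rename[OF sorted_swap[OF assms(2)] assms(1)] assms
  by (simp add: rename_swap_fresh perm_lvar_atom_var sorted_swap)

text \<open>At a sort, variables, constant spines and weak head redexes exclude each other. The only
  freedom is the atom chosen in \<open>nf_abs\<close>, and that disappears up to \<alpha>.\<close>

lemma nf_deterministic: "nf sg \<tau> s n \<Longrightarrow> nf sg \<tau> s m \<Longrightarrow> n = m"
proof (induction arbitrary: m rule: nf.induct)
  case (nf_atom a)
  then show ?case by (cases rule: nf.cases) auto
next
  case (nf_unknown \<tau>)
  from nf_unknown(2,1) show ?case by (cases rule: nf.cases) auto
next
  case (nf_const f \<tau>s \<tau> ss ns)
  note outer = nf_const
  from nf_const.prems show ?case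
  proof (cases rule: nf.cases)
    case (nf_const g \<sigma>s ts ms)
    then have eq: "g = f" "ts = ss" by (simp_all add: foldl_App_Const_inject)
    then have "\<sigma>s = \<tau>s" using nf_const outer by simp
    have "ns = ms"
    proof (rule nth_equalityI)
      show "length ns = length ms" using nf_const outer \<open>\<sigma>s = \<tau>s\<close> by simp
      fix i assume "i < length ns"
      then show "ns ! i = ms ! i" using nf_const outer \<open>\<sigma>s = \<tau>s\<close> eq by metis
    qed
    then show ?thesis using nf_const eq by simp
  next
    case (nf_step s')
    then show ?thesis by (simp add: not_wh_Const_spine)
  next
    case (nf_abs a \<tau>')
    then show ?thesis using outer by simp
  next
    case (nf_atom a)
    then show ?thesis by simp
  next
    case nf_unknown
    then show ?thesis by simp
  qed
next
  case (nf_step \<tau> s s' n)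
  note outer = nf_step
  from nf_step.prems show ?case
  proof (cases rule: nf.cases)
    case (nf_const g \<sigma>s ts ms)
    then show ?thesis using outer(2) by (simp add: not_wh_Const_spine)
  next
    case (nf_step s'')
    then show ?thesis using outer wh_deterministic by blast
  next
    case (nf_abs a \<tau>')
    then show ?thesis using outer(1) by simp
  next
    case (nf_atom a)
    then show ?thesis using outer(2) by blast
  next
    case nf_unknown
    then show ?thesis using outer(2) by blast
  qed
next
  case (nf_abs a s \<tau> n)
  from nf_abs.prems obtain b k where b: "atom_sort b = atom_sort a" "m = lam (atom_var b) k"
      "atom_var b \<notin> lfree s" "nf sg \<tau> (App s (Free (atom_var b))) k"
    by (rule nf_AbsTE)
  show ?case
  proof (cases "a = b")
    case True
    then show ?thesis using nf_abs.IH[of k] b by blast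
  next
    case False
    \<comment> \<open>Two different atoms were used: swapping carries the second derivation over to
      \<open>a\<close>, where the induction hypothesis applies.\<close>
    have "nf sg \<tau> (App s (Free (atom_var a))) (rename [(b, a)] k)"
      using nf_swap b nf_abs.hyps by metis
    then have "n = rename [(b, a)] k" by (rule nf_abs.IH)
    moreover have "atom_var a \<notin> lfree k"
      using nf_lfree[OF b(4)] nf_abs.hyps False by auto
    ultimately show ?thesis using lam_rename_swap[of b a k] False b by metis
  qed
qed

text \<open>\<open>nf_step\<close> acts only at sorts, so at abstraction types the reduction is
  pushed into the application to an atom.\<close>

lemma nf_expand: "wh s s' \<Longrightarrow> nf sg \<tau> s' n \<Longrightarrow> nf sg \<tau> s n"
proof (induction \<tau> arbitrary: s s' n)
  case (AbsT \<nu> \<tau>)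
  from AbsT.prems(2) obtain a k where a: "atom_sort a = \<nu>" "n = lam (atom_var a) k"
      "atom_var a \<notin> lfree s'" "nf sg \<tau> (App s' (Free (atom_var a))) k"
    by (rule nf_AbsTE)
  \<comment> \<open>Reduction can erase variables, so the atom \<open>a\<close> may still be free in
    \<open>s\<close>; it is exchanged for one that is fresh for \<open>s\<close> and
    \<open>k\<close>.\<close>
  obtain b where b: "atom_sort b = \<nu>" "b \<noteq> a" "atom_var b \<notin> lfree s \<union> lfree k"
    using ex_fresh_atom[of "lfree s \<union> lfree k" \<nu> a] finite_lfree by blast
  have "atom_var b \<notin> lfree s'" using b(3) wh_lfree[OF AbsT.prems(1)] by blast
  then have "nf sg \<tau> (App s' (Free (atom_var b))) (rename [(a, b)] k)"
    using nf_swap[OF a(4) _ a(3)] a(1) b(1) by simp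
  then have "nf sg \<tau> (App s (Free (atom_var b))) (rename [(a, b)] k)"
    using AbsT.IH wh_app[OF AbsT.prems(1)] by blast
  then have "nf sg (AbsT \<nu> \<tau>) s (lam (atom_var b) (rename [(a, b)] k))"
    using nf_abs[of b s] b by auto
  then show ?case using lam_rename_swap[of a b k] a b by auto
qed (auto intro: nf_step)

text \<open>Read-back: each rule except \<open>nf_step\<close> mirrors a term constructor. For the
  empty atom list \<open>NSusp [] X\<close> becomes a bare free variable.\<close>

lemma nf_trans_term: "nf sg \<tau> s n \<Longrightarrow> \<exists>t. ntyped sg t \<tau> \<and> n = trans_term [] t"
proof (induction rule: nf.induct)
  case (nf_atom a)
  then show ?case by (intro exI[of _ "NAtom a"]) (auto intro: ntyped.intros)
next
  case (nf_unknown \<tau>)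
  then show ?case
    using ntyped.intros(4)[of "[]" sg "NVar \<tau> 0"]
    by (intro exI[of _ "NSusp [] (NVar \<tau> 0)"]) auto
next
  case (nf_const f \<tau>s \<tau> ss ns)
  then obtain t where t: "\<forall>i < length \<tau>s. ntyped sg (t i) (\<tau>s ! i) \<and> ns ! i = trans_term [] (t i)"
    by metis
  let ?ts = "map t [0..<length \<tau>s]"
  have "list_all2 (ntyped sg) ?ts \<tau>s" using t by (auto simp: list_all2_conv_all_nth)
  moreover have "ns = map (trans_term []) ?ts" using t nf_const by (auto intro: nth_equalityI)
  ultimately show ?case
    using nf_const(1) by (intro exI[of _ "NFun f ?ts"]) (auto intro: ntyped.intros)
next
  case (nf_abs a s \<tau> n)
  then obtain t where "ntyped sg t \<tau>" "n = trans_term [] t" by blast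
  then show ?case by (intro exI[of _ "NAbs a t"]) (auto intro: ntyped.intros)
qed

section \<open>The logical relation\<close>

text \<open>The recursion covers all simple types, because terms in the range of a solution may
  contain subterms whose types translate no nominal type. Arguments are locally closed, so lifting
  and instantiation leave them alone.\<close>

fun rel ::
    "('s, 'd, 'f) signat \<Rightarrow> ('s, 'd) ltype \<Rightarrow> ('s, 'd, 'f) lterm \<Rightarrow> ('s, 'd, 'f) lterm \<Rightarrow> bool" where
  "rel sg (AtomB \<nu>) s s' = (\<exists>n. nf sg (AtomT \<nu>) s n \<and> nf sg (AtomT \<nu>) s' n)"
| "rel sg (DataB \<delta>) s s' = (\<exists>n. nf sg (DataT \<delta>) s n \<and> nf sg (DataT \<delta>) s' n)"
| "rel sg (Fun T U) s s' =
     (\<forall>u u'. lc u \<longrightarrow> lc u' \<longrightarrow> rel sg T u u' \<longrightarrow> rel sg U (App s u) (App s' u'))"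

lemma rel_sym: "rel sg T s s' \<Longrightarrow> rel sg T s' s"
  by (induction T arbitrary: s s') auto

lemma rel_trans: "rel sg T s s' \<Longrightarrow> rel sg T s' s'' \<Longrightarrow> rel sg T s s''"
proof (induction T arbitrary: s s' s'')
  case (Fun T U)
  show ?case
  proof (simp, intro allI impI)
    fix u u' assume u: "lc u" "lc u'" "rel sg T u u'"
    \<comment> \<open>By symmetry and transitivity at \<open>T\<close>; this allows
      \<open>u'\<close> on both sides of the second hypothesis.\<close>
    then have "rel sg T u' u'" using Fun.IH(1) rel_sym by blast
    then have "rel sg U (App s u) (App s' u')" "rel sg U (App s' u') (App s'' u')"
      using Fun.prems u by auto
    then show "rel sg U (App s u) (App s'' u')" by (rule Fun.IH(2))
  qed
qed (auto dest: nf_deterministic)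

lemma rel_expand_left: "wh s t \<Longrightarrow> rel sg T t s' \<Longrightarrow> rel sg T s s'"
proof (induction T arbitrary: s t s')
  case (Fun T U)
  then show ?case using wh_app by fastforce
qed (auto intro: nf_expand)

lemma rel_expand: "wh s t \<Longrightarrow> wh s' t' \<Longrightarrow> rel sg T t t' \<Longrightarrow> rel sg T s s'"
  by (meson rel_expand_left rel_sym)

lemma rel_trans_type_iff_sort:
  "is_sort \<tau> \<Longrightarrow> rel sg (trans_type \<tau>) s s' \<longleftrightarrow> (\<exists>n. nf sg \<tau> s n \<and> nf sg \<tau> s' n)"
  by (cases \<tau>) auto

lemma rel_atom_var: "rel sg (AtomB (atom_sort a)) (Free (atom_var a)) (Free (atom_var a))"
  using nf_atom by auto

text \<open>The argument of a translated abstraction type has an atom sort, so both functions can be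
  applied to an atom fresh for both, which is related to itself.\<close>

lemma rel_imp_nf: "rel sg (trans_type \<tau>) s s' \<Longrightarrow> \<exists>n. nf sg \<tau> s n \<and> nf sg \<tau> s' n"
proof (induction \<tau> arbitrary: s s')
  case (AbsT \<nu> \<tau>)
  obtain a where a: "atom_sort a = \<nu>" "atom_var a \<notin> lfree s \<union> lfree s'"
    using ex_fresh_atom[of "lfree s \<union> lfree s'"] finite_lfree by blast
  have "rel sg (trans_type \<tau>) (App s (Free (atom_var a))) (App s' (Free (atom_var a)))"
    using AbsT.prems rel_atom_var[of sg a] a by auto
  then obtain n where "nf sg \<tau> (App s (Free (atom_var a))) n" "nf sg \<tau> (App s' (Free (atom_var a))) n"
    using AbsT.IH by blast
  then show ?case using nf_abs a by blast
qed auto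

text \<open>\<open>\<tau>s1\<close> types the arguments already supplied and \<open>\<tau>s2\<close>
  those still awaited. Each new pair of arguments contributes a common normal form by
  \<open>rel_imp_nf\<close>, until the spine is saturated and \<open>nf_const\<close>
  applies.\<close>

lemma rel_const_spine:
  assumes "sg f = (\<tau>s, \<tau>)" "is_sort \<tau>"
  shows "\<tau>s = \<tau>s1 @ \<tau>s2 \<Longrightarrow> length ss = length \<tau>s1 \<Longrightarrow> length ss' = length \<tau>s1 \<Longrightarrow>
    length ns = length \<tau>s1 \<Longrightarrow>
    \<forall>i < length \<tau>s1. nf sg (\<tau>s1 ! i) (ss ! i) (ns ! i) \<and> nf sg (\<tau>s1 ! i) (ss' ! i) (ns ! i) \<Longrightarrow>
    rel sg (foldr Fun (map trans_type \<tau>s2) (trans_type \<tau>))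
      (foldl App (Const f) ss) (foldl App (Const f) ss')"
proof (induction \<tau>s2 arbitrary: \<tau>s1 ss ss' ns)
  case Nil
  then have "nf sg \<tau> (foldl App (Const f) ss) (foldl App (Const f) ns)"
    "nf sg \<tau> (foldl App (Const f) ss') (foldl App (Const f) ns)"
    using nf_const[of sg f \<tau>s \<tau>] assms by auto
  then show ?case using assms(2) by (auto simp: rel_trans_type_iff_sort)
next
  case (Cons \<tau>' \<tau>s2)
  show ?case
  proof (simp, intro allI impI)
    fix u u' assume "rel sg (trans_type \<tau>') u u'"
    then obtain n where n: "nf sg \<tau>' u n" "nf sg \<tau>' u' n" using rel_imp_nf by blast
    show "rel sg (foldr Fun (map trans_type \<tau>s2) (trans_type \<tau>))
        (App (foldl App (Const f) ss) u) (App (foldl App (Const f) ss') u')"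
      using Cons.IH[of "\<tau>s1 @ [\<tau>']" "ss @ [u]" "ss' @ [u']" "ns @ [n]"] Cons.prems n
      by (auto simp: nth_append less_Suc_eq)
  qed
qed

lemma rel_const:
  assumes "nominal_signature sg"
  shows "rel sg (const_type sg f) (Const f) (Const f)"
  using rel_const_spine[of sg f "fst (sg f)" "snd (sg f)" "[]" "fst (sg f)" "[]" "[]" "[]"] assms
  by (simp add: const_type_def nominal_signature_def)

text \<open>Even at an atom sort the value is an unknown, not an atom: terms closed off in this way
  contain no atoms and are fixed by renaming.\<close>

fun dummy :: "('s, 'd) ltype \<Rightarrow> ('s, 'd, 'f) lterm" where
  "dummy (AtomB \<nu>) = Free (unknown_var [] (NVar (AtomT \<nu>) 0))"
| "dummy (DataB \<delta>) = Free (unknown_var [] (NVar (DataT \<delta>) 0))"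
| "dummy (Fun T U) = Abs T (dummy U)"

lemma lc_dummy: "lc_at k (dummy T)"
  by (induction T arbitrary: k) auto

lemma atom_var_not_in_dummy: "atom_var a \<notin> lfree (dummy T)"
  by (induction T) auto

lemma rel_dummy:
  fixes sg :: "('s, 'd, 'f) signat"
  shows "rel sg T (dummy T) (dummy T)"
proof (induction T)
  case (Fun T U)
  have "wh (App (Abs T (dummy U)) u) (dummy U)" for u :: "('s, 'd, 'f) lterm"
    using wh_beta[of T "dummy U" u] by (simp add: inst_lc lc_dummy)
  then show ?case using Fun.IH(2) by (auto intro: rel_expand)
qed (auto intro!: exI nf_unknown)

text \<open>The closing substitution of the logical relation, with \<open>k\<close> counting the
  binders passed. The values \<open>\<delta> i\<close> are used locally closed and so are not
  lifted.\<close>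

fun msub :: "(nat \<Rightarrow> ('s, 'd, 'f) lterm) \<Rightarrow> nat \<Rightarrow> ('s, 'd, 'f) lterm \<Rightarrow> ('s, 'd, 'f) lterm" where
  "msub \<delta> k (Bound i) = (if i < k then Bound i else \<delta> (i - k))"
| "msub \<delta> k (Free x) = dummy (snd x)"
| "msub \<delta> k (Const f) = Const f"
| "msub \<delta> k (App s t) = App (msub \<delta> k s) (msub \<delta> k t)"
| "msub \<delta> k (Abs T s) = Abs T (msub \<delta> (Suc k) s)"

lemma lc_at_msub: "(\<And>i. lc (\<delta> i)) \<Longrightarrow> lc_at k (msub \<delta> k s)"
  by (induction s arbitrary: k) (auto simp: lc_dummy intro: lc_at_mono)

lemma msub_closed: "lc_at k s \<Longrightarrow> msub \<delta> k s = lsubst (\<lambda>x. dummy (snd x)) s"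
  by (induction s arbitrary: k) auto

text \<open>Contracting an applied abstraction amounts to extending the environment by its
  argument.\<close>

lemma inst_msub:
  "(\<And>i. lc (\<delta> i)) \<Longrightarrow> lc u \<Longrightarrow> inst k u (msub \<delta> (Suc k) s) = msub (case_nat u \<delta>) k s"
proof (induction s arbitrary: k)
  case (Bound i)
  consider "i < k" | "i = k" | j where "i = Suc (k + j)"
    using less_imp_Suc_add by (cases i k rule: linorder_cases) auto
  then show ?case using Bound by cases (auto simp: inst_lc Suc_diff_le)
qed (auto simp: inst_lc lc_dummy lift_lc)

lemma msub_lift:
  "(\<And>i. lc (\<delta> i)) \<Longrightarrow> j \<le> k \<Longrightarrow> msub \<delta> (Suc k) (lift j s) = lift j (msub \<delta> k s)"
  by (induction s arbitrary: j k) (auto simp: lift_lc lc_dummy)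

text \<open>The substitution lemma behind the \<beta> case: a contractum is interpreted like the
  body in the extended environment.\<close>

lemma msub_inst:
  "(\<And>i. lc (\<delta> i)) \<Longrightarrow> lc (msub \<delta> k u) \<Longrightarrow>
   msub \<delta> k (inst k u s) = msub (case_nat (msub \<delta> k u) \<delta>) k s"
proof (induction s arbitrary: k u)
  case (Bound i)
  consider "i < k" | "i = k" | j where "i = Suc (k + j)"
    using less_imp_Suc_add by (cases i k rule: linorder_cases) auto
  then show ?case using Bound by cases (auto simp: Suc_diff_le)
next
  case (Abs T s)
  then show ?case using Abs.IH[of "Suc k" "lift 0 u"] by (simp add: msub_lift lift_lc)
qed auto

text \<open>Closure is demanded at every index, also beyond \<open>\<Gamma>\<close>, so that the
  lemmas on \<open>msub\<close> apply without tracking the length of the context.\<close>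

definition rel_env ::
    "('s, 'd, 'f) signat \<Rightarrow> ('s, 'd) ltype list \<Rightarrow> (nat \<Rightarrow> ('s, 'd, 'f) lterm) \<Rightarrow>
     (nat \<Rightarrow> ('s, 'd, 'f) lterm) \<Rightarrow> bool" where
  "rel_env sg \<Gamma> \<delta> \<delta>' \<longleftrightarrow>
     (\<forall>i. lc (\<delta> i) \<and> lc (\<delta>' i)) \<and> (\<forall>i < length \<Gamma>. rel sg (\<Gamma> ! i) (\<delta> i) (\<delta>' i))"

lemma rel_env_sym: "rel_env sg \<Gamma> \<delta> \<delta>' \<Longrightarrow> rel_env sg \<Gamma> \<delta>' \<delta>"
  by (auto simp: rel_env_def intro: rel_sym)

lemma rel_env_refl: "rel_env sg \<Gamma> \<delta> \<delta>' \<Longrightarrow> rel_env sg \<Gamma> \<delta>' \<delta>'"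
  unfolding rel_env_def by (meson rel_sym rel_trans)

lemma rel_env_Cons:
  "rel_env sg \<Gamma> \<delta> \<delta>' \<Longrightarrow> lc u \<Longrightarrow> lc u' \<Longrightarrow> rel sg T u u' \<Longrightarrow>
   rel_env sg (T # \<Gamma>) (case_nat u \<delta>) (case_nat u' \<delta>')"
  by (auto simp: rel_env_def nth_Cons split: nat.split)

lemma rel_env_lc: "rel_env sg \<Gamma> \<delta> \<delta>' \<Longrightarrow> lc (\<delta> i)" "rel_env sg \<Gamma> \<delta> \<delta>' \<Longrightarrow> lc (\<delta>' i)"
  by (auto simp: rel_env_def)

lemma wh_msub_Abs:
  assumes "\<And>i. lc (\<delta> i)" "lc u"
  shows "wh (App (Abs T (msub \<delta> (Suc 0) s)) u) (msub (case_nat u \<delta>) 0 s)"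
  using wh_beta[of T "msub \<delta> (Suc 0) s" u] inst_msub[OF assms, where k = 0 and s = s] by simp

text \<open>Both applications take a head step to the bodies in extended environments, and the
  relation is closed under head expansion.\<close>

lemma rel_msub_Abs:
  assumes "rel_env sg \<Gamma> \<delta> \<delta>'"
    and "\<And>\<delta> \<delta>'. rel_env sg (T # \<Gamma>) \<delta> \<delta>' \<Longrightarrow> rel sg U (msub \<delta> 0 s) (msub \<delta>' 0 s')"
  shows "rel sg (Fun T U) (msub \<delta> 0 (Abs T s)) (msub \<delta>' 0 (Abs T s'))"
proof (simp, intro allI impI)
  fix u u' assume u: "lc u" "lc u'" "rel sg T u u'"
  then have "rel sg U (msub (case_nat u \<delta>) 0 s) (msub (case_nat u' \<delta>') 0 s')"
    using assms rel_env_Cons by blast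
  then show "rel sg U (App (Abs T (msub \<delta> (Suc 0) s)) u) (App (Abs T (msub \<delta>' (Suc 0) s')) u')"
    using wh_msub_Abs rel_env_lc[OF assms(1)] u by (blast intro: rel_expand)
qed

text \<open>The fundamental lemma of the logical relation.\<close>

lemma ltyped_imp_rel:
  assumes "nominal_signature sg"
  shows "ltyped sg \<Gamma> s T \<Longrightarrow> rel_env sg \<Gamma> \<delta> \<delta>' \<Longrightarrow> rel sg T (msub \<delta> 0 s) (msub \<delta>' 0 s)"
proof (induction arbitrary: \<delta> \<delta>' rule: ltyped.induct)
  case (1 i \<Gamma>)
  then show ?case by (simp add: rel_env_def)
next
  case (2 \<Gamma> x)
  then show ?case by (simp add: rel_dummy)
next
  case (3 \<Gamma> f)
  then show ?case by (simp add: rel_const assms)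
next
  case (4 \<Gamma> s T U t)
  then show ?case using lc_at_msub[of \<delta> 0 t] lc_at_msub[of \<delta>' 0 t] rel_env_lc[OF 4(5)] by simp
next
  case (5 T \<Gamma> s U)
  then show ?case using rel_msub_Abs by blast
qed

text \<open>Soundness for \<beta>\<eta>. Transitivity passes through the reflexive environment pair
  of \<open>\<delta>'\<close>; for \<eta> the relation is extensional, so one head step on the left
  suffices.\<close>

lemma lambda_eq_imp_rel:
  assumes "nominal_signature sg"
  shows "lambda_eq sg \<Gamma> s s' T \<Longrightarrow> rel_env sg \<Gamma> \<delta> \<delta>' \<Longrightarrow> rel sg T (msub \<delta> 0 s) (msub \<delta>' 0 s')"
proof (induction arbitrary: \<delta> \<delta>' rule: lambda_eq.induct)
  case (refl \<Gamma> s T)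
  then show ?case using ltyped_imp_rel[OF assms] by blast
next
  case (sym \<Gamma> s t T)
  then show ?case using rel_sym rel_env_sym by blast
next
  case (trans \<Gamma> s t T u)
  then show ?case using rel_trans rel_env_refl by blast
next
  case (app \<Gamma> s s' T U t t')
  then show ?case
    using lc_at_msub[of \<delta> 0 t] lc_at_msub[of \<delta>' 0 t'] rel_env_lc[OF app(5)] by simp
next
  case (abs T \<Gamma> s s' U)
  then show ?case using rel_msub_Abs by blast
next
  case (beta T \<Gamma> s U t)
  let ?u = "msub \<delta> 0 t" and ?u' = "msub \<delta>' 0 t"
  have lc: "lc ?u" "lc ?u'" using rel_env_lc[OF beta(3)] by (auto intro: lc_at_msub)
  have "rel sg T ?u ?u'" using ltyped_imp_rel[OF assms beta(2,3)] .
  then have "rel sg U (msub (case_nat ?u \<delta>) 0 s) (msub (case_nat ?u' \<delta>') 0 s)"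
    using ltyped_imp_rel[OF assms beta(1)] rel_env_Cons[OF beta(3)] lc by blast
  then have "rel sg U (App (Abs T (msub \<delta> (Suc 0) s)) ?u) (msub \<delta>' 0 (inst 0 t s))"
    using wh_msub_Abs[of \<delta> ?u T s] rel_env_lc[OF beta(3)] lc
    by (auto simp: msub_inst intro: rel_expand_left)
  then show ?case by simp
next
  case (eta \<Gamma> s T U)
  have rel: "rel sg (Fun T U) (msub \<delta> 0 s) (msub \<delta>' 0 s)"
    using ltyped_imp_rel[OF assms eta] .
  have lc: "lc (msub \<delta> 0 s)" using rel_env_lc[OF eta(2)] by (auto intro: lc_at_msub)
  have "msub \<delta> (Suc 0) (lift 0 s) = msub \<delta> 0 s"
    using rel_env_lc[OF eta(2)] lc by (simp add: msub_lift lift_lc)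
  then have "wh (App (msub \<delta> 0 (Abs T (App (lift 0 s) (Bound 0)))) u) (App (msub \<delta> 0 s) u)" for u
    using wh_beta[of T "App (msub \<delta> 0 s) (Bound 0)" u] lc by (simp add: inst_lc)
  then show ?case using rel by (auto intro: rel_expand_left)
qed

lemma lambda_eq_imp_rel_closed:
  assumes "nominal_signature sg" "lambda_eq sg [] s s' T"
  shows "rel sg T (lsubst (\<lambda>x. dummy (snd x)) s) (lsubst (\<lambda>x. dummy (snd x)) s')"
proof -
  \<comment> \<open>In the empty context any locally closed filler serves as environment.\<close>
  have "rel_env sg [] (\<lambda>i. dummy T) (\<lambda>i. dummy T)" by (simp add: rel_env_def lc_dummy)
  from lambda_eq_imp_rel[OF assms this] show ?thesis
    using lambda_eq_ltyped[OF assms(2)] by (auto simp: msub_closed dest!: lc_at_ltyped)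
qed

lemma rel_apply_atoms:
  "rel sg (foldr Fun (map (\<lambda>a. AtomB (atom_sort a)) as) T) s s' \<Longrightarrow>
   rel sg T (foldl App s (map (\<lambda>a. Free (atom_var a)) as))
     (foldl App s' (map (\<lambda>a. Free (atom_var a)) as))"
proof (induction as arbitrary: s s')
  case (Cons a as)
  then have "rel sg (foldr Fun (map (\<lambda>a. AtomB (atom_sort a)) as) T)
      (App s (Free (atom_var a))) (App s' (Free (atom_var a)))"
    using rel_atom_var[of sg a] by simp
  then show ?case using Cons.IH by simp
qed simp

section \<open>From equal normal forms to nominal equality\<close>

fun nterm_vars :: "('s, 'd, 'f) nterm \<Rightarrow> ('s, 'd) nvar set" where
  "nterm_vars (NFun f ts) = (\<Union>t \<in> set ts. nterm_vars t)"
| "nterm_vars (NAtom a) = {}"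
| "nterm_vars (NAbs a t) = nterm_vars t"
| "nterm_vars (NSusp \<pi> X) = {X}"

lemma finite_nterm_vars: "finite (nterm_vars t)"
  by (induction t) auto

lemma finite_nterm_atoms: "finite (nterm_atoms t)"
  by (induction t) auto

lemma nterm_vars_perm: "nterm_vars (perm_nterm \<pi> t) = nterm_vars t"
  by (induction t) auto

lemma nterm_atoms_perm:
  "fst ` set \<pi> \<union> snd ` set \<pi> \<subseteq> A \<Longrightarrow> nterm_atoms t \<subseteq> A \<Longrightarrow> nterm_atoms (perm_nterm \<pi> t) \<subseteq> A"
proof (induction t)
  case (NAtom a)
  then show ?case using perm_atom_closed[of \<pi> A a] by simp
next
  case (NAbs a t)
  then show ?case using perm_atom_closed[of \<pi> A a] by simp
next
  case (NFun f ts)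
  have "nterm_atoms (perm_nterm \<pi> t) \<subseteq> A" if "t \<in> set ts" for t
    using NFun.IH[OF that NFun.prems(1)] NFun.prems(2) that by auto
  then show ?case by auto
qed auto

lemma lc_trans_term: "lc (trans_term as t)"
  by (induction t) (auto simp: lc_at_foldl_App lc_lam)

text \<open>For the empty atom list the translation forgets suspended permutations, and renaming
  fixes unknowns, so the two sides agree on suspensions too.\<close>

lemma trans_term_perm:
  "sorted_perm \<pi> \<Longrightarrow> trans_term [] (perm_nterm \<pi> t) = rename \<pi> (trans_term [] t)"
  by (induction t) (auto simp: lsubst_foldl_App foldl_App_Const_inject rename_lam perm_lvar_atom_var)

text \<open>At a suspension the environment \<open>A \<times> V\<close> supplies the constraint,
  since \<open>A\<close> contains the atoms of \<open>\<pi>\<close> and is therefore closed under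
  its inverse.\<close>

lemma fresh_if_not_in_lfree:
  assumes "a \<in> A"
  shows "nterm_atoms t \<subseteq> A \<Longrightarrow> nterm_vars t \<subseteq> V \<Longrightarrow> atom_var a \<notin> lfree (trans_term [] t) \<Longrightarrow>
    (A \<times> V) \<turnstile> a \<sharp> t"
proof (induction t)
  case (NFun f ts)
  have "\<forall>t \<in> set ts. (A \<times> V) \<turnstile> a \<sharp> t"
  proof
    fix t assume "t \<in> set ts"
    with NFun.prems show "(A \<times> V) \<turnstile> a \<sharp> t"
      by (intro NFun.IH) (auto simp: lfree_foldl_App)
  qed
  then show ?case by (rule fresh.intros)
next
  case (NAtom b)
  then show ?case by (auto intro: fresh.intros)
next
  case (NAbs b t)
  then show ?case by (cases "a = b") (auto simp: lfree_lam intro: fresh.intros)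
next
  case (NSusp \<pi> X)
  then show ?case using perm_atom_closed[of "rev \<pi>" A a] assms by (auto intro: fresh.intros)
qed

text \<open>The translation loses only suspended permutations, and \<open>A \<times> V\<close> makes
  every atom on which two of them can differ fresh. The term \<open>u\<close> is generalized because
  the induction hypothesis is applied to a swapped body.\<close>

lemma nominal_eq_if_trans_term_eq:
  "trans_term [] t = trans_term [] u \<Longrightarrow> nterm_atoms t \<subseteq> A \<Longrightarrow> nterm_atoms u \<subseteq> A \<Longrightarrow>
   nterm_vars t \<subseteq> V \<Longrightarrow> nterm_vars u \<subseteq> V \<Longrightarrow> (A \<times> V) \<turnstile> t \<approx> u"
proof (induction t arbitrary: u)
  case (NFun f ts)
  from NFun.prems(1) obtain us where u: "u = NFun f us" "map (trans_term []) ts = map (trans_term []) us"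
    by (cases u) (auto simp: foldl_App_Const_inject lam_def)
  have len: "length ts = length us" using map_eq_imp_length_eq u(2) .
  have "list_all2 (nominal_eq (A \<times> V)) ts us"
  proof (rule list_all2_all_nthI[OF len])
    fix i assume i: "i < length ts"
    have "trans_term [] (ts ! i) = trans_term [] (us ! i)"
      using u(2) i len by (metis nth_map)
    moreover have "ts ! i \<in> set ts" "us ! i \<in> set us" using i len by auto
    ultimately show "(A \<times> V) \<turnstile> ts ! i \<approx> us ! i"
      using NFun.prems(2-) u(1) by (intro NFun.IH) auto
  qed
  then show ?case unfolding u(1) by (rule nominal_eq.intros)
next
  case (NAtom a)
  then have "u = NAtom a" by (cases u) (auto simp: lam_def)
  then show ?case by (auto intro: nominal_eq.intros)
next
  case (NAbs a t)
  from NAbs.prems(1) obtain b u' where u: "u = NAbs b u'"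
    by (cases u) (auto simp: lam_def)
  have eq: "lam (atom_var a) (trans_term [] t) = lam (atom_var b) (trans_term [] u')"
    using NAbs.prems(1) u by simp
  show ?case
  proof (cases "a = b")
    case True
    have "trans_term [] t = trans_term [] u'"
      using arg_cong[OF eq, of "\<lambda>s. case s of Abs T r \<Rightarrow> inst 0 (Free (atom_var a)) r"] True
      by (simp add: lam_def inst_bind_var lc_trans_term)
    then show ?thesis using NAbs u True by (auto intro: nominal_eq.intros)
  next
    case False
    note * = lam_atom_var_eqD[OF eq False lc_trans_term lc_trans_term]
    have "trans_term [] t = trans_term [] (perm_nterm [(a, b)] u')"
      using *(3) by (simp add: trans_term_perm sorted_swap *(1))
    then have "(A \<times> V) \<turnstile> t \<approx> perm_nterm [(a, b)] u'"
      using NAbs.prems u nterm_atoms_perm[of "[(a, b)]" A u']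
      by (intro NAbs.IH) (auto simp: nterm_vars_perm)
    moreover have "(A \<times> V) \<turnstile> a \<sharp> u'"
      using NAbs.prems u *(2) by (intro fresh_if_not_in_lfree) auto
    ultimately show ?thesis unfolding u using False by (intro nominal_eq.intros)
  qed
next
  case (NSusp \<pi> X)
  then obtain \<pi>' where u: "u = NSusp \<pi>' X" by (cases u) (auto simp: lam_def)
  have "fst ` set \<pi> \<union> snd ` set \<pi> \<subseteq> A" "fst ` set \<pi>' \<union> snd ` set \<pi>' \<subseteq> A"
    using NSusp.prems u by simp_all
  \<comment> \<open>Outside \<open>A\<close> both permutations are the identity.\<close>
  then have "a \<in> A" if "perm_atom \<pi> a \<noteq> perm_atom \<pi>' a" for a
    using that perm_atom_fixed by metis
  then show ?case unfolding u using NSusp.prems by (auto intro: nominal_eq.intros)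
qed

section \<open>Reading back a solution\<close>

text \<open>The form that \<open>\<theta>\<close> takes below binders for the atoms of
  \<open>A\<close>.\<close>

definition keep_atoms ::
    "'s atom set \<Rightarrow> (('s, 'd) lvar \<Rightarrow> ('s, 'd, 'f) lterm) \<Rightarrow> ('s, 'd) lvar \<Rightarrow> ('s, 'd, 'f) lterm" where
  "keep_atoms A \<theta> x = (if x \<in> atom_var ` A then Free x else \<theta> x)"

lemma keep_atoms_atom_var: "a \<in> A \<Longrightarrow> keep_atoms A \<theta> (atom_var a) = Free (atom_var a)"
  by (simp add: keep_atoms_def)

lemma keep_atoms_unknown_var: "keep_atoms A \<theta> (unknown_var as X) = \<theta> (unknown_var as X)"
  by (auto simp: keep_atoms_def)

lemma keep_atoms_insert:
  "(keep_atoms A \<theta>)(atom_var a := Free (atom_var a)) = keep_atoms (insert a A) \<theta>"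
  by (auto simp: keep_atoms_def)

lemma lsubst_keep_atoms_lam:
  assumes "\<And>x b. atom_var b \<notin> lfree (\<theta> x)"
  shows "lsubst (keep_atoms A \<theta>) (lam (atom_var a) s)
    = lam (atom_var a) (lsubst (keep_atoms (insert a A) \<theta>) s)"
proof -
  have "atom_var a \<notin> lfree (keep_atoms A \<theta> y)" if "y \<noteq> atom_var a" for y
    using that assms by (auto simp: keep_atoms_def)
  from lsubst_lam[OF this] show ?thesis by (simp add: keep_atoms_insert)
qed

lemma lsubst_keep_atoms_close:
  assumes "\<And>x b. atom_var b \<notin> lfree (\<theta> x)"
  shows "lsubst (keep_atoms A \<theta>) (foldr (\<lambda>a. lam (atom_var a)) as s)
    = foldr (\<lambda>a. lam (atom_var a)) as (lsubst (keep_atoms (set as \<union> A) \<theta>) s)"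
proof (induction as arbitrary: A)
  case (Cons a as)
  then show ?case using lsubst_keep_atoms_lam[OF assms] by simp
qed simp

text \<open>Applying the closure to the same atoms head-reduces it back to \<open>s\<close>, and
  \<open>nf_expand\<close> carries the normal form along.\<close>

lemma nf_apply_close:
  "lc s \<Longrightarrow> nf sg \<tau> s n \<Longrightarrow>
   nf sg \<tau> (foldl App (foldr (\<lambda>a. lam (atom_var a)) as s) (map (\<lambda>a. Free (atom_var a)) as)) n"
proof (induction as)
  case (Cons a as)
  have wh_spine: "wh (foldl App r ts) (foldl App r' ts)" if "wh r r'" for r r' ts
    using that by (induction ts arbitrary: r r') (auto intro: wh_app)
  have "lc (foldr (\<lambda>a. lam (atom_var a)) as s)"
    using Cons.prems(1) by (induction as) (auto intro: lc_lam)
  from wh_spine[OF wh_lam[OF this, of "atom_var a"], of "map (\<lambda>a. Free (atom_var a)) as"] Cons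
  show ?case by (auto intro: nf_expand)
qed simp

text \<open>The substitutions \<open>\<theta>\<close> and \<open>\<sigma>\<close> correspond under
  translation. For a suspension, \<open>\<theta>\<close> has no atoms in its range, so permuting the
  arguments renames the whole application and \<open>nf_rename\<close> transfers the assumption on
  \<open>X\<close>.\<close>

lemma nf_trans_term_nsubst:
  assumes sg: "nominal_signature sg"
    and lc: "\<And>x. lc (\<theta> x)"
    and no_atoms: "\<And>x b. atom_var b \<notin> lfree (\<theta> x)"
    and \<sigma>: "\<And>X. X \<in> V \<Longrightarrow> nf sg (nvar_type X)
      (foldl App (\<theta> (unknown_var as X)) (map (\<lambda>a. Free (atom_var a)) as)) (trans_term [] (\<sigma> X))"
  shows "ntyped sg t \<tau> \<Longrightarrow> nterm_atoms t \<subseteq> set as \<Longrightarrow> nterm_vars t \<subseteq> V \<Longrightarrow>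
    nf sg \<tau> (lsubst (keep_atoms (set as) \<theta>) (trans_term as t)) (trans_term [] (nsubst \<sigma> t))"
proof (induction rule: ntyped.induct)
  case (1 f \<tau>s \<tau> ts)
  have "is_sort \<tau>" using sg 1(1) unfolding nominal_signature_def by (metis snd_conv)
  moreover have len: "length ts = length \<tau>s" using 1(2) by (rule list_all2_lengthD)
  moreover have "nf sg (\<tau>s ! i) (lsubst (keep_atoms (set as) \<theta>) (trans_term as (ts ! i)))
      (trans_term [] (nsubst \<sigma> (ts ! i)))" if "i < length \<tau>s" for i
  proof -
    have "ts ! i \<in> set ts" using that len by simp
    then have "nterm_atoms (ts ! i) \<subseteq> set as" "nterm_vars (ts ! i) \<subseteq> V"
      using 1(3,4) by auto
    then show ?thesis using list_all2_nthD2[OF 1(2) that] by blast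
  qed
  ultimately show ?case
    using nf_const[of sg f \<tau>s \<tau> "map (lsubst (keep_atoms (set as) \<theta>) \<circ> trans_term as) ts"
        "map (trans_term [] \<circ> nsubst \<sigma>) ts"] 1(1)
    by (simp add: lsubst_foldl_App)
next
  case (2 a)
  then show ?case by (simp add: keep_atoms_atom_var nf_atom)
next
  case (3 t \<tau> a)
  let ?s = "lsubst (keep_atoms (set as) \<theta>) (trans_term as t)"
  have "lc ?s"
    by (rule lc_at_lsubst) (auto simp: keep_atoms_def lc lc_trans_term)
  then have "nf sg \<tau> (App (lam (atom_var a) ?s) (Free (atom_var a))) (trans_term [] (nsubst \<sigma> t))"
    using 3 by (intro nf_expand[OF wh_lam]) simp_all
  \<comment> \<open>The binder \<open>a\<close> occurs in the term and hence in \<open>as\<close>,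
    so the set of kept atoms does not grow.\<close>
  moreover have "insert a (set as) = set as" using 3 by auto
  ultimately show ?case
    by (simp add: lsubst_keep_atoms_lam[OF no_atoms] lfree_lam nf_abs)
next
  case (4 \<pi> X)
  then have sp: "sorted_perm \<pi>" by (simp add: sorted_perm_def)
  have "lsubst (keep_atoms (set as) \<theta>) (trans_term as (NSusp \<pi> X))
      = foldl App (\<theta> (unknown_var as X)) (map (\<lambda>a. Free (atom_var (perm_atom \<pi> a))) as)"
    using 4 perm_atom_closed[of \<pi> "set as"]
    by (auto simp: lsubst_foldl_App keep_atoms_unknown_var keep_atoms_atom_var
        intro!: arg_cong[of _ _ "foldl App _"])
  also have "\<dots> = rename \<pi> (foldl App (\<theta> (unknown_var as X)) (map (\<lambda>a. Free (atom_var a)) as))"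
    by (simp add: lsubst_foldl_App rename_no_atoms no_atoms perm_lvar_atom_var[OF sp] comp_def)
  finally show ?case
    using nf_rename[OF sp \<sigma>[of X]] 4 trans_term_perm[OF sp, of "\<sigma> X"] by simp
qed

theorem theorem7p7:
  fixes sg :: "('s, 'd, 'f) signat"
    and P :: "('s, 'd, 'f) nproblem"
    and as :: "'s atom list"
  assumes "nominal_signature sg"
    and "nominal_problem sg P"
    and "distinct as" and "set as = problem_atoms P"
    and "lambda_solvable sg (trans_problem as P)"
  shows "nominal_solvable sg P"
proof -
  obtain \<theta> where \<theta>: "lambda_substitution sg \<theta>"
    and eqs: "\<forall>(s, s') \<in> trans_problem as P. \<exists>T. lambda_eq sg [] (lsubst \<theta> s) (lsubst \<theta> s') T"
    using assms(5) unfolding lambda_solvable_def by (elim exE conjE)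
  have \<theta>_typed: "ltyped sg [] (\<theta> x) (snd x)" for x
    using \<theta> unfolding lambda_substitution_def by blast
  define \<rho> :: "('s, 'd) lvar \<Rightarrow> ('s, 'd, 'f) lterm" where "\<rho> = (\<lambda>x. dummy (snd x))"
  define \<theta>' where "\<theta>' = (\<lambda>x. lsubst \<rho> (\<theta> x))"
  have lc: "lc (\<theta>' x)" for x
    using lc_at_ltyped[OF \<theta>_typed[of x]] by (auto simp: \<theta>'_def \<rho>_def lc_dummy intro: lc_at_lsubst)
  have no_atoms: "atom_var b \<notin> lfree (\<theta>' x)" for x b
    by (auto simp: \<theta>'_def \<rho>_def lfree_lsubst atom_var_not_in_dummy)
  let ?atoms = "map (\<lambda>a. Free (atom_var a)) as"

  have "\<exists>t. ntyped sg t (nvar_type X) \<and>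
      nf sg (nvar_type X) (foldl App (\<theta>' (unknown_var as X)) ?atoms) (trans_term [] t)" for X
  proof -
    \<comment> \<open>Reflexivity of \<beta>\<eta>-equality makes the term self-related, which
      yields a normal form to read back.\<close>
    have "rel sg (snd (unknown_var as X)) (\<theta>' (unknown_var as X)) (\<theta>' (unknown_var as X))"
      unfolding \<theta>'_def \<rho>_def
      by (intro lambda_eq_imp_rel_closed[OF assms(1)] lambda_eq.refl \<theta>_typed)
    then have "rel sg (trans_type (nvar_type X)) (foldl App (\<theta>' (unknown_var as X)) ?atoms)
        (foldl App (\<theta>' (unknown_var as X)) ?atoms)"
      by (intro rel_apply_atoms) (simp add: unknown_var_def)
    then show ?thesis using rel_imp_nf nf_trans_term by blast
  qed
  then obtain \<sigma>0 where \<sigma>0: "\<And>X. ntyped sg (\<sigma>0 X) (nvar_type X)"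
    "\<And>X. nf sg (nvar_type X) (foldl App (\<theta>' (unknown_var as X)) ?atoms) (trans_term [] (\<sigma>0 X))"
    by metis
  have finP: "finite P" using assms(2) by (simp add: nominal_problem_def)
  define V where "V = (\<Union>(t, u) \<in> P. nterm_vars t \<union> nterm_vars u)"
  \<comment> \<open>Restriction to the unknowns of \<open>P\<close> gives finite support.\<close>
  define \<sigma> where "\<sigma> X = (if X \<in> V then \<sigma>0 X else NSusp [] X)" for X
  have "finite V" unfolding V_def using finP by (auto simp: finite_nterm_vars)
  then have "finite {X. \<sigma> X \<noteq> NSusp [] X}"
    by (rule rev_finite_subset) (auto simp: \<sigma>_def)
  moreover have "ntyped sg (\<sigma> X) (nvar_type X)" for X
    using \<sigma>0(1) ntyped.intros(4)[of "[]" sg X] by (simp add: \<sigma>_def)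
  ultimately have subst: "nominal_substitution sg \<sigma>" by (simp add: nominal_substitution_def)

  \<comment> \<open>Taken after substitution, because \<open>\<sigma>\<close> may bring in new
    binder names and unknowns.\<close>
  define A where "A = (\<Union>(t, u) \<in> P. nterm_atoms (nsubst \<sigma> t) \<union> nterm_atoms (nsubst \<sigma> u))"
  define W where "W = (\<Union>(t, u) \<in> P. nterm_vars (nsubst \<sigma> t) \<union> nterm_vars (nsubst \<sigma> u))"
  have "finite (A \<times> W)"
    unfolding A_def W_def using finP
    by (intro finite_cartesian_product) (auto simp: finite_nterm_vars finite_nterm_atoms)
  moreover have "(A \<times> W) \<turnstile> nsubst \<sigma> t \<approx> nsubst \<sigma> u" if tu: "(t, u) \<in> P" for t u
  proof (rule nominal_eq_if_trans_term_eq)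
    obtain \<tau> where \<tau>: "ntyped sg t \<tau>" "ntyped sg u \<tau>"
      using assms(2) tu by (auto simp: nominal_problem_def)
    obtain T where T: "lambda_eq sg [] (lsubst \<theta> (close_term as t)) (lsubst \<theta> (close_term as u)) T"
      using eqs tu by (fastforce simp: trans_problem_def)
    \<comment> \<open>The existentially given type is pinned down by uniqueness of typing.\<close>
    have "T = foldr Fun (map (\<lambda>a. AtomB (atom_sort a)) as) (trans_type \<tau>)"
      using lambda_eq_ltyped[OF T] ltyped_lsubst[OF \<theta>_typed ltyped_close_term[OF \<tau>(1)]]
        ltyped_unique by blast
    then have "rel sg (trans_type \<tau>) (foldl App (lsubst \<theta>' (close_term as t)) ?atoms)
        (foldl App (lsubst \<theta>' (close_term as u)) ?atoms)"
      using lambda_eq_imp_rel_closed[OF assms(1) T]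
      by (intro rel_apply_atoms) (simp add: lsubst_lsubst \<theta>'_def \<rho>_def)
    then obtain n where n: "nf sg \<tau> (foldl App (lsubst \<theta>' (close_term as t)) ?atoms) n"
        "nf sg \<tau> (foldl App (lsubst \<theta>' (close_term as u)) ?atoms) n"
      using rel_imp_nf by blast
    have nf: "nf sg \<tau> (foldl App (lsubst \<theta>' (close_term as v)) ?atoms) (trans_term [] (nsubst \<sigma> v))"
      if v: "v = t \<or> v = u" for v
    proof -
      have "nterm_atoms v \<subseteq> set as" unfolding assms(4) problem_atoms_def using tu v by blast
      moreover have "nterm_vars v \<subseteq> V" unfolding V_def using tu v by blast
      moreover have "ntyped sg v \<tau>" using \<tau> v by blast
      ultimately have "nf sg \<tau> (lsubst (keep_atoms (set as) \<theta>') (trans_term as v))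
          (trans_term [] (nsubst \<sigma> v))"
        using \<sigma>0(2) by (intro nf_trans_term_nsubst[OF assms(1) lc no_atoms]) (auto simp: \<sigma>_def)
      moreover have "lc (lsubst (keep_atoms (set as) \<theta>') (trans_term as v))"
        by (rule lc_at_lsubst) (auto simp: keep_atoms_def lc lc_trans_term)
      \<comment> \<open>Starting with no kept atoms, passing the closing binders accumulates exactly
        \<open>set as\<close>.\<close>
      moreover have "keep_atoms {} \<theta>' = \<theta>'" by (auto simp: keep_atoms_def)
      then have "lsubst \<theta>' (close_term as v)
          = foldr (\<lambda>a. lam (atom_var a)) as (lsubst (keep_atoms (set as) \<theta>') (trans_term as v))"
        using lsubst_keep_atoms_close[where \<theta> = \<theta>' and A = "{}", OF no_atoms]
        by (simp add: close_term_def)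
      ultimately show ?thesis by (simp add: nf_apply_close)
    qed
    show "trans_term [] (nsubst \<sigma> t) = trans_term [] (nsubst \<sigma> u)"
      using n nf nf_deterministic by metis
  qed (use tu in \<open>auto simp: A_def W_def\<close>)
  ultimately show ?thesis using subst unfolding nominal_solvable_def by blast
qed

end
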